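(* Let $\alpha_1,\alpha_2,\alpha_3\in\mathbb{C}$ be the three roots of the polynomial $x^3-x^2+1$, and let $\widetilde{F}=\mathbb{Q}(\alpha_1,\alpha_2,\alpha_3)$ be the normal closure of $\mathbb{Q}(\alpha_1)$ over $\mathbb{Q}$. Then the subgroups $\langle c_5(\alpha_1)\rangle$, $\langle c_5(\alpha_2)\rangle$, $\langle c_5(\alpha_3)\rangle$ of $K_2(\widetilde{F})$ are nontrivial cyclotomic subgroups (i.e. they are contained in $G_5(\widetilde{F})$) and they are different from each other. Hence $G_5(\widetilde{F})$ contains at least three nontrivial cyclotomic subgroups.
   Context: For a field $E$, $K_2(E)$ is the Milnor $K_2$-group (written multiplicatively, generated by symbols $\{a,b\}$, $a,b\in E^*$). $\Phi_5(x)=x^4+x^3+x^2+x+1$; for $a\in E^*$ with $\Phi_5(a)\neq0$ put $c_5(a)=\{a,\Phi_5(a)\}\in K_2(E)$, and $G_5(E)=\{c_5(a)\mid a,\Phi_5(a)\in E^*\}$. A subgroup of $K_2(E)$ is called cyclotomic if it is contained in $G_5(E)$. *)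

theory Defs
  imports
    "HOL-Algebra.Free_Abelian_Groups"
    "HOL-Algebra.Generated_Fields"
    "HOL-Algebra.Algebraic_Closure_Type"
    "HOL-Computational_Algebra.Fundamental_Theorem_Algebra"
begin

definition nonzero_elements :: "('a, 'm) ring_scheme \<Rightarrow> 'a set"
  where "nonzero_elements E = carrier E - {\<zero>\<^bsub>E\<^esub>}"

text \<open>
  The Milnor group of a field, \<open>K\<^sub>2(E) = (E\<^sup>* \<otimes> E\<^sup>*) / \<langle>a \<otimes> (1 - a)\<rangle>\<close>: the free abelian group
  on the pairs of nonzero elements modulo bimultiplicativity and the Steinberg relations.
  The free abelian group is written additively; the quotient is a multiplicative
  group of HOL-Algebra.
\<close>

definition milnor_relations :: "('a, 'm) ring_scheme \<Rightarrow> ('a \<times> 'a \<Rightarrow>\<^sub>0 int) set"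
  where "milnor_relations E =
      {frag_of (a \<otimes>\<^bsub>E\<^esub> b, c) - frag_of (a, c) - frag_of (b, c) | a b c.
         a \<in> nonzero_elements E \<and> b \<in> nonzero_elements E \<and> c \<in> nonzero_elements E}
    \<union> {frag_of (a, b \<otimes>\<^bsub>E\<^esub> c) - frag_of (a, b) - frag_of (a, c) | a b c.
         a \<in> nonzero_elements E \<and> b \<in> nonzero_elements E \<and> c \<in> nonzero_elements E}
    \<union> {frag_of (a, \<one>\<^bsub>E\<^esub> \<ominus>\<^bsub>E\<^esub> a) | a. a \<in> nonzero_elements E \<and> a \<noteq> \<one>\<^bsub>E\<^esub>}"

definition milnor_free :: "('a, 'm) ring_scheme \<Rightarrow> ('a \<times> 'a \<Rightarrow>\<^sub>0 int) monoid"
  where "milnor_free E = free_Abelian_group (nonzero_elements E \<times> nonzero_elements E)"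

definition milnor_kernel :: "('a, 'm) ring_scheme \<Rightarrow> ('a \<times> 'a \<Rightarrow>\<^sub>0 int) set"
  where "milnor_kernel E = generate (milnor_free E) (milnor_relations E)"

definition K2 :: "('a, 'm) ring_scheme \<Rightarrow> ('a \<times> 'a \<Rightarrow>\<^sub>0 int) set monoid"
  where "K2 E = milnor_free E Mod milnor_kernel E"

text \<open>The symbol \<open>{a, b}\<close>; meaningful only for \<open>a, b \<in> E\<^sup>*\<close>.\<close>

definition K2_symbol :: "('a, 'm) ring_scheme \<Rightarrow> 'a \<Rightarrow> 'a \<Rightarrow> ('a \<times> 'a \<Rightarrow>\<^sub>0 int) set"
  where "K2_symbol E a b = milnor_kernel E #>\<^bsub>milnor_free E\<^esub> frag_of (a, b)"

definition Phi5 :: "('a, 'm) ring_scheme \<Rightarrow> 'a \<Rightarrow> 'a"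
  where "Phi5 E x = x [^]\<^bsub>E\<^esub> (4::nat) \<oplus>\<^bsub>E\<^esub> x [^]\<^bsub>E\<^esub> (3::nat) \<oplus>\<^bsub>E\<^esub> x [^]\<^bsub>E\<^esub> (2::nat)
                  \<oplus>\<^bsub>E\<^esub> x \<oplus>\<^bsub>E\<^esub> \<one>\<^bsub>E\<^esub>"

text \<open>\<open>c5 E a\<close> is meaningful only for \<open>a\<close> in the set \<open>c5_domain E\<close>.\<close>

definition c5_domain :: "('a, 'm) ring_scheme \<Rightarrow> 'a set"
  where "c5_domain E = {a \<in> nonzero_elements E. Phi5 E a \<in> nonzero_elements E}"

definition c5 :: "('a, 'm) ring_scheme \<Rightarrow> 'a \<Rightarrow> ('a \<times> 'a \<Rightarrow>\<^sub>0 int) set"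
  where "c5 E a = K2_symbol E a (Phi5 E a)"

definition G5 :: "('a, 'm) ring_scheme \<Rightarrow> ('a \<times> 'a \<Rightarrow>\<^sub>0 int) set set"
  where "G5 E = {c5 E a | a. a \<in> c5_domain E}"

definition cyclotomic_subgroup ::
    "('a, 'm) ring_scheme \<Rightarrow> ('a \<times> 'a \<Rightarrow>\<^sub>0 int) set set \<Rightarrow> bool"
  where "cyclotomic_subgroup E H \<longleftrightarrow> subgroup H (K2 E) \<and> H \<subseteq> G5 E"

definition nontrivial_cyclotomic_subgroup ::
    "('a, 'm) ring_scheme \<Rightarrow> ('a \<times> 'a \<Rightarrow>\<^sub>0 int) set set \<Rightarrow> bool"
  where "nontrivial_cyclotomic_subgroup E H \<longleftrightarrow>
           cyclotomic_subgroup E H \<and> H \<noteq> {\<one>\<^bsub>K2 E\<^esub>}"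

text \<open>The subfield \<open>\<rat>(S)\<close> of the complex numbers.\<close>

definition rat_adjoin :: "complex set \<Rightarrow> complex ring"
  where "rat_adjoin S =
    ring_of_type_algebra \<lparr>carrier := generate_field ring_of_type_algebra (\<rat> \<union> S)\<rparr>"

end

theory Submission
  imports Defs
begin

text \<open>
  Let \<open>a\<close> be a root of \<open>x\<^sup>3 - x\<^sup>2 + 1\<close>, so that \<open>a\<close> is a unit with \<open>1 - a = a\<^sup>-\<^sup>2\<close> and
  \<open>\<Phi>\<^sub>5(a) = 3a\<^sup>2 - 1\<close> has norm 11.

  \<^bold>\<open>The subgroup is cyclotomic.\<close> The Steinberg relation for \<open>a\<close> gives \<open>{a, a}\<^sup>2 = 1\<close>, so multiplying
  the second entry of a symbol \<open>{a\<^sup>i, b}\<close> by an even power of \<open>a\<close> does not change it. Since \<open>\<Phi>\<^sub>5(a\<^sup>i)\<close>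
  is \<open>\<Phi>\<^sub>5(a)\<close> times an even power of \<open>a\<close> for \<open>i = -2, -1, 1, 2\<close> (this is where the choice of the
  cubic enters: \<open>\<Phi>\<^sub>5(a\<^sup>2) = \<Phi>\<^sub>5(a) \<Phi>\<^sub>5(-a)\<close> and \<open>\<Phi>\<^sub>5(-a) = (1 - a)\<^sup>2\<close>), one gets
  \<open>c\<^sub>5(a)\<^sup>i = c\<^sub>5(a\<^sup>i)\<close>. Also \<open>1 - a\<^sup>5 = \<Phi>\<^sub>5(a) a\<^sup>-\<^sup>2\<close>, whence the Steinberg relation for \<open>a\<^sup>5\<close> gives
  \<open>c\<^sub>5(a)\<^sup>5 = 1\<close>, and these exponents exhaust the cyclic group (\<open>cyclotomic_subgroup_c5\<close>).

  \<^bold>\<open>The subgroups are nontrivial and distinct.\<close> Let \<open>\<alpha>, \<beta>, \<gamma>\<close> be the roots. The element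
  \<open>\<pi> = \<Phi>\<^sub>5(\<alpha>)\<close> is a prime of \<open>\<int>[\<alpha>]\<close> with residue field of 11 elements, in which \<open>\<alpha>\<close> becomes 9, a
  primitive fifth root of unity. The quadratic polynomial with roots \<open>\<beta>, \<gamma>\<close> stays irreducible
  modulo 11, so \<open>\<pi>\<close> is still prime in \<open>\<int>[\<alpha>, \<beta>]\<close> and defines a discrete valuation of the
  splitting field. Its tame symbol sends \<open>c\<^sub>5(\<alpha>)\<close> to the class of \<open>\<alpha>\<close>, which is not 1, and sends
  \<open>c\<^sub>5(\<beta>)\<close> to 1 because \<open>\<beta>\<close> and \<open>\<Phi>\<^sub>5(\<beta>)\<close> are both prime to \<open>\<pi>\<close>. Hence \<open>c\<^sub>5(\<alpha>)\<close> does not lie in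
  the group generated by \<open>c\<^sub>5(\<beta>)\<close> (\<open>c5_notin_generate\<close>); as the roots are interchangeable, this
  gives both assertions.

  The tame symbol is taken with values in the multiplicative group modulo the principal units,
  which contains the multiplicative group of the residue field. The valuation is extracted from a subring with a prime element whose powers have zero
  intersection (\<open>separated_prime\<close>), and that situation is verified by explicit coordinates.
\<close>

section \<open>Symbols in the Milnor group\<close>

context field
begin

lemma nonzero_elements_mult:
  "\<lbrakk>a \<in> nonzero_elements R; b \<in> nonzero_elements R\<rbrakk> \<Longrightarrow> a \<otimes> b \<in> nonzero_elements R"
  by (simp add: nonzero_elements_def integral_iff)

lemma one_nonzero_element: "\<one> \<in> nonzero_elements R"
  by (simp add: nonzero_elements_def)

lemma one_minus_nonzero:
  "\<lbrakk>a \<in> nonzero_elements R; a \<noteq> \<one>\<rbrakk> \<Longrightarrow> \<one> \<ominus> a \<in> nonzero_elements R"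
  by (auto simp: nonzero_elements_def)

lemma frag_of_milnor_free:
  "\<lbrakk>a \<in> nonzero_elements R; b \<in> nonzero_elements R\<rbrakk> \<Longrightarrow> frag_of (a, b) \<in> carrier (milnor_free R)"
  by (simp add: milnor_free_def)

lemma comm_group_milnor_free: "comm_group (milnor_free R)"
  by (simp add: milnor_free_def abelian_free_Abelian_group)

lemma milnor_free_simps:
  "x \<otimes>\<^bsub>milnor_free R\<^esub> y = x + y"
  "\<one>\<^bsub>milnor_free R\<^esub> = 0"
  by (simp_all add: milnor_free_def)

lemma milnor_free_diff:
  assumes "x \<in> carrier (milnor_free R)" "y \<in> carrier (milnor_free R)"
  shows "x - y \<in> carrier (milnor_free R)"
  using assms keys_diff[of x y] by (auto simp: milnor_free_def)

lemma milnor_relations_subset: "milnor_relations R \<subseteq> carrier (milnor_free R)"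
  unfolding milnor_relations_def
  by (auto intro!: milnor_free_diff frag_of_milnor_free nonzero_elements_mult one_minus_nonzero)

lemma subgroup_milnor_kernel: "subgroup (milnor_kernel R) (milnor_free R)"
  unfolding milnor_kernel_def
  by (intro group.generate_is_subgroup milnor_relations_subset comm_group.axioms comm_group_milnor_free)

lemma normal_milnor_kernel: "milnor_kernel R \<lhd> milnor_free R"
  by (intro comm_group.subgroup_imp_normal subgroup_milnor_kernel comm_group_milnor_free)

lemma comm_group_K2: "comm_group (K2 R)"
  unfolding K2_def by (intro comm_group.abelian_FactGroup subgroup_milnor_kernel comm_group_milnor_free)

lemma K2_symbol_closed:
  "\<lbrakk>a \<in> nonzero_elements R; b \<in> nonzero_elements R\<rbrakk> \<Longrightarrow> K2_symbol R a b \<in> carrier (K2 R)"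
  by (simp add: K2_def K2_symbol_def carrier_FactGroup frag_of_milnor_free)

lemma coset_add:
  assumes "x \<in> carrier (milnor_free R)" "y \<in> carrier (milnor_free R)"
  shows "milnor_kernel R #>\<^bsub>milnor_free R\<^esub> (x + y) =
    (milnor_kernel R #>\<^bsub>milnor_free R\<^esub> x) \<otimes>\<^bsub>K2 R\<^esub> (milnor_kernel R #>\<^bsub>milnor_free R\<^esub> y)"
  using hom_mult[OF normal.r_coset_hom_Mod[OF normal_milnor_kernel] assms]
  by (simp add: K2_def milnor_free_simps)

lemma coset_relation:
  assumes "r \<in> milnor_relations R"
  shows "milnor_kernel R #>\<^bsub>milnor_free R\<^esub> r = \<one>\<^bsub>K2 R\<^esub>"
proof -
  have "r \<in> milnor_kernel R" unfolding milnor_kernel_def by (rule generate.incl) (rule assms)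
  then show ?thesis
    using subgroup.rcos_const[OF subgroup_milnor_kernel] comm_group_milnor_free
    by (simp add: K2_def comm_group_def)
qed

text \<open>
  Both bilinearity relations have the shape \<open>u - x - y\<close>, so the two product rules for symbols follow
  from this one computation in the quotient.
\<close>

lemma coset_bilinear_relation:
  assumes "u - x - y \<in> milnor_relations R"
    "x \<in> carrier (milnor_free R)" "y \<in> carrier (milnor_free R)"
  shows "milnor_kernel R #>\<^bsub>milnor_free R\<^esub> u =
    (milnor_kernel R #>\<^bsub>milnor_free R\<^esub> x) \<otimes>\<^bsub>K2 R\<^esub> (milnor_kernel R #>\<^bsub>milnor_free R\<^esub> y)"
proof -
  interpret M: comm_group "milnor_free R" by (rule comm_group_milnor_free)
  interpret K: comm_group "K2 R" by (rule comm_group_K2)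
  have xy: "x + y \<in> carrier (milnor_free R)"
    using M.m_closed[OF assms(2,3)] by (simp add: milnor_free_simps)
  have r: "u - x - y \<in> carrier (milnor_free R)" using assms(1) milnor_relations_subset by blast
  have "milnor_kernel R #>\<^bsub>milnor_free R\<^esub> (x + y) \<in> carrier (K2 R)"
    using xy by (simp add: K2_def carrier_FactGroup)
  then have "milnor_kernel R #>\<^bsub>milnor_free R\<^esub> ((u - x - y) + (x + y)) =
      milnor_kernel R #>\<^bsub>milnor_free R\<^esub> (x + y)"
    by (simp only: coset_add[OF r xy] coset_relation[OF assms(1)] K.l_one)
  then show ?thesis by (simp add: coset_add[OF assms(2,3)])
qed

lemma K2_symbol_mult_left:
  assumes "a \<in> nonzero_elements R" "b \<in> nonzero_elements R" "c \<in> nonzero_elements R"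
  shows "K2_symbol R (a \<otimes> b) c = K2_symbol R a c \<otimes>\<^bsub>K2 R\<^esub> K2_symbol R b c"
  unfolding K2_symbol_def
  by (intro coset_bilinear_relation frag_of_milnor_free assms)
    (use assms in \<open>auto simp: milnor_relations_def\<close>)

lemma K2_symbol_mult_right:
  assumes "a \<in> nonzero_elements R" "b \<in> nonzero_elements R" "c \<in> nonzero_elements R"
  shows "K2_symbol R a (b \<otimes> c) = K2_symbol R a b \<otimes>\<^bsub>K2 R\<^esub> K2_symbol R a c"
  unfolding K2_symbol_def
  by (intro coset_bilinear_relation frag_of_milnor_free assms)
    (use assms in \<open>auto simp: milnor_relations_def\<close>)

lemma K2_symbol_steinberg:
  assumes "a \<in> nonzero_elements R" "a \<noteq> \<one>"
  shows "K2_symbol R a (\<one> \<ominus> a) = \<one>\<^bsub>K2 R\<^esub>"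
  unfolding K2_symbol_def
  by (rule coset_relation) (use assms in \<open>auto simp: milnor_relations_def\<close>)

text \<open>
  In each entry the symbol is a homomorphism on the multiplicative group of the field, so its values on
  integer powers come from the general theory of homomorphisms.
\<close>

lemma K2_symbol_hom_left:
  assumes "b \<in> nonzero_elements R"
  shows "group_hom (Multiplicative_Group.mult_of R) (K2 R) (\<lambda>a. K2_symbol R a b)"
  using assms comm_group_K2 field_mult_group K2_symbol_closed K2_symbol_mult_left
  by (auto simp: group_hom_def group_hom_axioms_def hom_def comm_group_def nonzero_elements_def)

lemma K2_symbol_hom_right:
  assumes "a \<in> nonzero_elements R"
  shows "group_hom (Multiplicative_Group.mult_of R) (K2 R) (\<lambda>b. K2_symbol R a b)"
  using assms comm_group_K2 field_mult_group K2_symbol_closed K2_symbol_mult_right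
  by (auto simp: group_hom_def group_hom_axioms_def hom_def comm_group_def nonzero_elements_def)

text \<open>
  Milnor's group is the universal target of bimultiplicative Steinberg symbols: extend \<open>f\<close> to the free
  abelian group; each generator of the relation subgroup is then sent to the unit, so the extension
  factors through the quotient.
\<close>

theorem K2_universal:
  fixes G :: "('g, 'h) monoid_scheme" and f :: "'a \<Rightarrow> 'a \<Rightarrow> 'g"
  assumes G: "comm_group G"
    and closed: "\<And>a b. \<lbrakk>a \<in> nonzero_elements R; b \<in> nonzero_elements R\<rbrakk> \<Longrightarrow> f a b \<in> carrier G"
    and left: "\<And>a b c. \<lbrakk>a \<in> nonzero_elements R; b \<in> nonzero_elements R; c \<in> nonzero_elements R\<rbrakk>
      \<Longrightarrow> f (a \<otimes> b) c = f a c \<otimes>\<^bsub>G\<^esub> f b c"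
    and right: "\<And>a b c. \<lbrakk>a \<in> nonzero_elements R; b \<in> nonzero_elements R; c \<in> nonzero_elements R\<rbrakk>
      \<Longrightarrow> f a (b \<otimes> c) = f a b \<otimes>\<^bsub>G\<^esub> f a c"
    and steinberg: "\<And>a. \<lbrakk>a \<in> nonzero_elements R; a \<noteq> \<one>\<rbrakk> \<Longrightarrow> f a (\<one> \<ominus> a) = \<one>\<^bsub>G\<^esub>"
  obtains \<phi> where "\<phi> \<in> hom (K2 R) G"
    "\<And>a b. \<lbrakk>a \<in> nonzero_elements R; b \<in> nonzero_elements R\<rbrakk> \<Longrightarrow> \<phi> (K2_symbol R a b) = f a b"
proof -
  interpret G: comm_group G by (rule G)
  interpret M: comm_group "milnor_free R" by (rule comm_group_milnor_free)
  have img: "(\<lambda>(a, b). f a b) ` (nonzero_elements R \<times> nonzero_elements R) \<subseteq> carrier G"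
    using closed by auto
  obtain h where h: "h \<in> hom (milnor_free R) G"
    "\<And>x. x \<in> nonzero_elements R \<times> nonzero_elements R \<Longrightarrow> h (frag_of x) = (\<lambda>(a, b). f a b) x"
    using G.free_Abelian_group_universal[OF img] unfolding milnor_free_def by metis
  interpret h: group_hom "milnor_free R" G h
    using h(1) by unfold_locales
  have h_frag: "h (frag_of (a, b)) = f a b" if "a \<in> nonzero_elements R" "b \<in> nonzero_elements R" for a b
    using h(2) that by simp
  have h_diff: "h (u - x - y) = \<one>\<^bsub>G\<^esub>"
    if "u \<in> carrier (milnor_free R)" "x \<in> carrier (milnor_free R)" "y \<in> carrier (milnor_free R)"
      "h u = h x \<otimes>\<^bsub>G\<^esub> h y" for u x y
  proof -
    have d: "u - x - y \<in> carrier (milnor_free R)" using that by (simp add: milnor_free_diff)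
    have xy: "x + y \<in> carrier (milnor_free R)"
      using M.m_closed[OF that(2,3)] by (simp add: milnor_free_simps)
    have "h ((u - x - y) \<otimes>\<^bsub>milnor_free R\<^esub> (x \<otimes>\<^bsub>milnor_free R\<^esub> y)) = h (u - x - y) \<otimes>\<^bsub>G\<^esub> (h x \<otimes>\<^bsub>G\<^esub> h y)"
      using that d by simp
    then have "h u = h (u - x - y) \<otimes>\<^bsub>G\<^esub> h u" using that(4) by (simp add: milnor_free_simps)
    then show ?thesis using that(1) d by (metis G.r_cancel_one' h.hom_closed)
  qed
  have "milnor_relations R \<subseteq> kernel (milnor_free R) G h"
  proof
    fix r assume r: "r \<in> milnor_relations R"
    have "h r = \<one>\<^bsub>G\<^esub>"
      using r unfolding milnor_relations_def
      by (auto intro!: h_diff simp: frag_of_milnor_free nonzero_elements_mult one_minus_nonzero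
          h_frag left right steinberg)
    then show "r \<in> kernel (milnor_free R) G h"
      using r milnor_relations_subset by (auto simp: kernel_def)
  qed
  then have "milnor_kernel R \<subseteq> kernel (milnor_free R) G h"
    unfolding milnor_kernel_def by (intro M.generate_subgroup_incl h.subgroup_kernel)
  then have ker: "\<And>x. x \<in> milnor_kernel R \<Longrightarrow> h x = \<one>\<^bsub>G\<^esub>" by (auto simp: kernel_def)
  have "h x = h y"
    if "x \<in> carrier (milnor_free R)" "y \<in> carrier (milnor_free R)"
      "milnor_kernel R #>\<^bsub>milnor_free R\<^esub> x = milnor_kernel R #>\<^bsub>milnor_free R\<^esub> y" for x y
  proof -
    have "x \<in> milnor_kernel R #>\<^bsub>milnor_free R\<^esub> y"
      using that M.rcos_self[OF _ subgroup_milnor_kernel] by metis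
    then obtain k where k: "k \<in> milnor_kernel R" "x = k \<otimes>\<^bsub>milnor_free R\<^esub> y" by (auto simp: r_coset_def)
    moreover have "k \<in> carrier (milnor_free R)"
      using k subgroup.subset[OF subgroup_milnor_kernel] by blast
    ultimately show ?thesis using ker that by simp
  qed
  then obtain g where "g \<in> hom (K2 R) G"
    "\<And>x. x \<in> carrier (milnor_free R) \<Longrightarrow> g (milnor_kernel R #>\<^bsub>milnor_free R\<^esub> x) = h x"
    using FactGroup_universal[OF h(1) normal_milnor_kernel] unfolding K2_def by metis
  then show ?thesis using that by (simp add: K2_symbol_def frag_of_milnor_free h_frag)
qed

end

section \<open>The cyclotomic subgroup attached to a root of the cubic\<close>

lemma field_rat_adjoin: "field (rat_adjoin S)"
proof -
  interpret C: field "ring_of_type_algebra :: complex ring" by (rule field_from_type_algebra)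
  show ?thesis
    unfolding rat_adjoin_def by (rule C.generate_field_is_field) (simp add: ring_of_type_algebra_def)
qed

lemma rat_adjoin_ops [simp]:
  "x \<otimes>\<^bsub>rat_adjoin S\<^esub> y = x * y"
  "x \<oplus>\<^bsub>rat_adjoin S\<^esub> y = x + y"
  "\<one>\<^bsub>rat_adjoin S\<^esub> = 1"
  "\<zero>\<^bsub>rat_adjoin S\<^esub> = 0"
  by (simp_all add: rat_adjoin_def ring_of_type_algebra_def)

lemma rat_adjoin_pow [simp]: "x [^]\<^bsub>rat_adjoin S\<^esub> (n :: nat) = x ^ n"
  by (induction n) (simp_all add: nat_pow_def)

lemma rat_adjoin_incl: "x \<in> S \<Longrightarrow> x \<in> carrier (rat_adjoin S)"
  by (simp add: rat_adjoin_def generate_field.incl)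

text \<open>
  The field operations of \<open>\<rat>(S)\<close> are those of the complex numbers; the point of this locale is to
  replace the one by the other once and for all.
\<close>

locale rational_adjunction =
  fixes S :: "complex set" and F :: "complex ring"
  defines F: "F \<equiv> rat_adjoin S"
begin

sublocale field F unfolding F by (rule field_rat_adjoin)

lemma ops [simp]:
  "x \<otimes>\<^bsub>F\<^esub> y = x * y"
  "x \<oplus>\<^bsub>F\<^esub> y = x + y"
  "\<one>\<^bsub>F\<^esub> = 1"
  "\<zero>\<^bsub>F\<^esub> = 0"
  "x [^]\<^bsub>F\<^esub> (n :: nat) = x ^ n"
  by (simp_all add: F)

lemma Phi5_eq: "Phi5 F x = x ^ 4 + x ^ 3 + x ^ 2 + x + 1"
  by (simp add: Phi5_def)

lemma minus_eq:
  assumes "x \<in> carrier F" "y \<in> carrier F"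
  shows "x \<ominus>\<^bsub>F\<^esub> y = x - y"
proof -
  have "(x \<ominus>\<^bsub>F\<^esub> y) \<oplus>\<^bsub>F\<^esub> y = x" using assms by algebra
  then show ?thesis by (simp add: algebra_simps)
qed

lemma mem_F_iff: "x \<in> nonzero_elements F \<longleftrightarrow> x \<in> carrier F \<and> x \<noteq> 0"
  by (simp add: nonzero_elements_def)

lemma unit_int_pow:
  assumes "x \<in> nonzero_elements F"
  shows "x [^]\<^bsub>Multiplicative_Group.mult_of F\<^esub> (i :: int) = x powi i"
proof -
  interpret U: group "Multiplicative_Group.mult_of F" by (rule field_mult_group)
  have x: "x \<in> carrier (Multiplicative_Group.mult_of F)" "x \<noteq> 0" using assms by (auto simp: mem_F_iff)
  have nat: "x [^]\<^bsub>Multiplicative_Group.mult_of F\<^esub> n = x ^ n" for n :: nat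
    by (induction n) (simp_all add: mult.commute)
  have inv: "inv\<^bsub>Multiplicative_Group.mult_of F\<^esub> y = inverse y"
    if "y \<in> carrier (Multiplicative_Group.mult_of F)" for y
  proof -
    have "inv\<^bsub>Multiplicative_Group.mult_of F\<^esub> y * y = 1" using U.l_inv[OF that] by simp
    then show ?thesis by (metis inverse_unique mult.commute)
  qed
  show ?thesis
    using inv[OF U.nat_pow_closed[OF x(1)]] x
    by (simp add: int_pow_def2 power_int_def nat power_inverse)
qed

lemma powi_mem: "x \<in> nonzero_elements F \<Longrightarrow> x powi (i :: int) \<in> nonzero_elements F"
  using group.int_pow_closed[OF field_mult_group, of x i] by (simp add: unit_int_pow mem_F_iff)

lemma K2_symbol_powi_left:
  assumes "a \<in> nonzero_elements F" "b \<in> nonzero_elements F"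
  shows "K2_symbol F (a powi i) b = K2_symbol F a b [^]\<^bsub>K2 F\<^esub> (i :: int)"
  using group_hom.hom_int_pow[OF K2_symbol_hom_left[OF assms(2)], of a i] assms
  by (simp add: unit_int_pow mem_F_iff)

lemma K2_symbol_powi_right:
  assumes "a \<in> nonzero_elements F" "b \<in> nonzero_elements F"
  shows "K2_symbol F a (b powi i) = K2_symbol F a b [^]\<^bsub>K2 F\<^esub> (i :: int)"
  using group_hom.hom_int_pow[OF K2_symbol_hom_right[OF assms(1)], of b i] assms
  by (simp add: unit_int_pow mem_F_iff)

lemma Phi5_closed: "x \<in> carrier F \<Longrightarrow> Phi5 F x \<in> carrier F"
  unfolding Phi5_def by (intro add.m_closed nat_pow_closed one_closed)

context
  fixes a :: complex
  assumes a_mem: "a \<in> carrier F" and root: "a ^ 3 - a ^ 2 + 1 = 0"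
begin

lemma root_nonzero: "a \<noteq> 0" "a \<noteq> 1"
  using root by auto

lemma Phi5_root_nonzero: "Phi5 F a \<noteq> 0"
proof
  assume "Phi5 F a = 0"
  then have "a ^ 4 + a ^ 3 + a ^ 2 + a + 1 = 0" by (simp add: Phi5_eq)
  \<comment> \<open>The resultant of the two polynomials is 11 up to sign.\<close>
  with root have "(11 :: complex) = 0" by Groebner_Basis.algebra
  then show False by simp
qed

lemma a_unit: "a \<in> nonzero_elements F" and Phi5_unit: "Phi5 F a \<in> nonzero_elements F"
  using a_mem root_nonzero Phi5_root_nonzero Phi5_closed by (auto simp: mem_F_iff simp del: ops)

lemma one_minus_root: "1 - a = a powi (- 2)"
proof -
  have "(1 - a) * a ^ 2 = 1" using root by Groebner_Basis.algebra
  then show ?thesis using root_nonzero by (simp add: power_int_minus field_simps)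
qed

text \<open>
  By \<open>1 - a = a\<^sup>-\<^sup>2\<close>, the Steinberg relation \<open>{a, 1 - a} = 1\<close> reads \<open>{a, a}\<^sup>-\<^sup>2 = 1\<close>.
\<close>

lemma symbol_root_root: "K2_symbol F a a [^]\<^bsub>K2 F\<^esub> (2 :: int) = \<one>\<^bsub>K2 F\<^esub>"
proof -
  interpret K: comm_group "K2 F" by (rule comm_group_K2)
  have s: "K2_symbol F a a \<in> carrier (K2 F)" by (intro K2_symbol_closed a_unit)
  have "K2_symbol F a a [^]\<^bsub>K2 F\<^esub> (- 2 :: int) = \<one>\<^bsub>K2 F\<^esub>"
    using K2_symbol_steinberg[OF a_unit] root_nonzero K2_symbol_powi_right[OF a_unit a_unit, of "- 2"]
    by (simp add: minus_eq a_mem one_closed[simplified] one_minus_root)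
  then have "inv\<^bsub>K2 F\<^esub> (K2_symbol F a a [^]\<^bsub>K2 F\<^esub> (2 :: int)) = \<one>\<^bsub>K2 F\<^esub>"
    using s by (simp add: K.int_pow_neg)
  then show ?thesis using s K.inv_eq_1_iff K.int_pow_closed by blast
qed

text \<open>
  The factor \<open>{a\<^sup>i, a\<^sup>2\<^sup>j}\<close> is a power of \<open>{a, a}\<^sup>2 = 1\<close>. This is what makes symbols insensitive to
  even powers of \<open>a\<close> in the second entry.
\<close>

lemma symbol_twist:
  "K2_symbol F (a powi i) (Phi5 F a * a powi (2 * j)) = c5 F a [^]\<^bsub>K2 F\<^esub> i"
proof -
  interpret K: comm_group "K2 F" by (rule comm_group_K2)
  have s: "K2_symbol F a a \<in> carrier (K2 F)" by (intro K2_symbol_closed a_unit)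
  have c: "c5 F a \<in> carrier (K2 F)" unfolding c5_def by (intro K2_symbol_closed a_unit Phi5_unit)
  have "K2_symbol F (a powi i) (a powi (2 * j)) = (K2_symbol F a a [^]\<^bsub>K2 F\<^esub> i) [^]\<^bsub>K2 F\<^esub> (2 * j)"
    by (simp add: K2_symbol_powi_left K2_symbol_powi_right a_unit powi_mem)
  also have "\<dots> = (K2_symbol F a a [^]\<^bsub>K2 F\<^esub> (2 :: int)) [^]\<^bsub>K2 F\<^esub> (i * j)"
    by (simp add: K.int_pow_pow s mult_ac)
  also have "\<dots> = \<one>\<^bsub>K2 F\<^esub>" by (simp add: symbol_root_root)
  finally have "K2_symbol F (a powi i) (a powi (2 * j)) = \<one>\<^bsub>K2 F\<^esub>" .
  moreover have "K2_symbol F (a powi i) (Phi5 F a) = c5 F a [^]\<^bsub>K2 F\<^esub> i"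
    unfolding c5_def by (intro K2_symbol_powi_left a_unit Phi5_unit)
  ultimately show ?thesis
    using K2_symbol_mult_right[of "a powi i" "Phi5 F a" "a powi (2 * j)"] a_unit Phi5_unit powi_mem c
    by simp
qed

lemma c5_powi:
  assumes "Phi5 F (a powi i) = Phi5 F a * a powi (2 * j)"
  shows "c5 F a [^]\<^bsub>K2 F\<^esub> i \<in> G5 F"
proof -
  have "c5 F a [^]\<^bsub>K2 F\<^esub> i = c5 F (a powi i)"
    unfolding c5_def[of F "a powi i"] assms symbol_twist ..
  moreover have "Phi5 F (a powi i) \<in> nonzero_elements F"
    unfolding assms using nonzero_elements_mult[OF Phi5_unit powi_mem[OF a_unit, of "2 * j"]]
    by simp
  ultimately show ?thesis
    unfolding G5_def c5_domain_def using powi_mem[OF a_unit, of i] by blast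
qed

text \<open>
  The first identity is the special feature of the cubic: \<open>\<Phi>\<^sub>5(a\<^sup>2) / \<Phi>\<^sub>5(a) = \<Phi>\<^sub>5(-a) = (1 - a)\<^sup>2 = a\<^sup>-\<^sup>4\<close>.
  The second holds for every \<open>a \<noteq> 0\<close> because \<open>\<Phi>\<^sub>5\<close> is reciprocal, and the third combines the two.
\<close>

lemma root_relations:
  "(a^2)^4 + (a^2)^3 + (a^2)^2 + a^2 + 1 = (a^4 + a^3 + a^2 + a + 1) / a^4"
  "(1/a)^4 + (1/a)^3 + (1/a)^2 + 1/a + 1 = (a^4 + a^3 + a^2 + a + 1) / a^4"
  "(1/a^2)^4 + (1/a^2)^3 + (1/a^2)^2 + 1/a^2 + 1 = (a^4 + a^3 + a^2 + a + 1) / a^12"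
proof -
  have sq: "((a^2)^4 + (a^2)^3 + (a^2)^2 + a^2 + 1) * a^4 = a^4 + a^3 + a^2 + a + 1"
    using root by Groebner_Basis.algebra
  have rec: "(1/x)^4 + (1/x)^3 + (1/x)^2 + 1/x + 1 = (x^4 + x^3 + x^2 + x + 1) / x^4"
    if "x \<noteq> 0" for x :: complex
    using that by (simp add: field_simps power_numeral_reduce)
  show first: "(a^2)^4 + (a^2)^3 + (a^2)^2 + a^2 + 1 = (a^4 + a^3 + a^2 + a + 1) / a^4"
    using sq root_nonzero by (simp add: eq_divide_eq)
  show "(1/a)^4 + (1/a)^3 + (1/a)^2 + 1/a + 1 = (a^4 + a^3 + a^2 + a + 1) / a^4"
    by (rule rec) (rule root_nonzero)
  have "(1/a^2)^4 + (1/a^2)^3 + (1/a^2)^2 + 1/a^2 + 1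
      = ((a^4 + a^3 + a^2 + a + 1) / a^4) / (a^2)^4"
    using rec[of "a^2"] root_nonzero unfolding first by simp
  then show "(1/a^2)^4 + (1/a^2)^3 + (1/a^2)^2 + 1/a^2 + 1 = (a^4 + a^3 + a^2 + a + 1) / a^12"
    by (simp flip: power_mult power_add)
qed

lemma Phi5_root_powi:
  "Phi5 F (a powi 2) = Phi5 F a * a powi (2 * (- 2))"
  "Phi5 F (a powi (- 1)) = Phi5 F a * a powi (2 * (- 2))"
  "Phi5 F (a powi (- 2)) = Phi5 F a * a powi (2 * (- 6))"
proof -
  have e: "a powi 2 = a ^ 2" "a powi (- 1) = 1 / a" "a powi (- 2) = 1 / a ^ 2"
    "x * a powi (2 * (- 2)) = x / a ^ 4" "x * a powi (2 * (- 6)) = x / a ^ 12" for x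
    by (simp_all add: power_int_minus divide_inverse)
  show "Phi5 F (a powi 2) = Phi5 F a * a powi (2 * (- 2))"
    unfolding e Phi5_eq by (rule root_relations)
  show "Phi5 F (a powi (- 1)) = Phi5 F a * a powi (2 * (- 2))"
    unfolding e Phi5_eq by (rule root_relations)
  show "Phi5 F (a powi (- 2)) = Phi5 F a * a powi (2 * (- 6))"
    unfolding e Phi5_eq by (rule root_relations)
qed

text \<open>
  The Steinberg relation for \<open>a\<^sup>5\<close>, since \<open>1 - a\<^sup>5 = \<Phi>\<^sub>5(a) (1 - a) = \<Phi>\<^sub>5(a) a\<^sup>-\<^sup>2\<close>.
\<close>

lemma c5_order: "c5 F a [^]\<^bsub>K2 F\<^esub> (5 :: int) = \<one>\<^bsub>K2 F\<^esub>"
proof -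
  have a5: "1 - a ^ 5 = Phi5 F a * a powi (2 * (- 1))"
  proof -
    have "1 - a ^ 5 = Phi5 F a * (1 - a)" by (simp add: Phi5_eq algebra_simps power_numeral_reduce)
    then show ?thesis by (simp only: one_minus_root) simp
  qed
  have "1 - a ^ 5 \<noteq> 0" using Phi5_root_nonzero root_nonzero unfolding a5 by simp
  moreover have "a powi 5 \<in> nonzero_elements F" by (intro powi_mem a_unit)
  ultimately have "K2_symbol F (a ^ 5) (1 - a ^ 5) = \<one>\<^bsub>K2 F\<^esub>"
    using K2_symbol_steinberg[of "a ^ 5"] one_closed by (simp add: minus_eq mem_F_iff)
  then show ?thesis using symbol_twist[of 5 "- 1"] by (simp add: a5)
qed

text \<open>
  As \<open>c\<^sub>5(a)\<^sup>5 = 1\<close>, every power of \<open>c\<^sub>5(a)\<close> has an exponent in \<open>{-2, ..., 2}\<close>, where it equals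
  \<open>c\<^sub>5(a\<^sup>i)\<close>.
\<close>

theorem cyclotomic_subgroup_c5: "cyclotomic_subgroup F (generate (K2 F) {c5 F a})"
proof -
  interpret K: comm_group "K2 F" by (rule comm_group_K2)
  have c: "c5 F a \<in> carrier (K2 F)" unfolding c5_def by (intro K2_symbol_closed a_unit Phi5_unit)
  have small: "c5 F a [^]\<^bsub>K2 F\<^esub> i \<in> G5 F" if "i \<in> {-2, -1, 0, 1, 2}" for i :: int
  proof -
    consider "i = - 2" | "i = - 1" | "i = 0" | "i = 1" | "i = 2" using \<open>i \<in> {-2, -1, 0, 1, 2}\<close> by auto
    then show ?thesis
    proof cases
      case 1
      show ?thesis unfolding 1 by (rule c5_powi) (rule Phi5_root_powi)
    next
      case 2
      show ?thesis unfolding 2 by (rule c5_powi) (rule Phi5_root_powi)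
    next
      case 3
      \<comment> \<open>The neutral element is \<open>c\<^sub>5(1) = {1, 5}\<close>.\<close>
      have "(5 :: complex) \<in> carrier F" using Phi5_closed[OF one_closed] by (simp add: Phi5_eq)
      then have 5: "(5 :: complex) \<in> nonzero_elements F" by (simp add: mem_F_iff)
      have "c5 F 1 = \<one>\<^bsub>K2 F\<^esub>"
        using group_hom.hom_one[OF K2_symbol_hom_left[OF 5]] by (simp add: c5_def Phi5_eq)
      moreover have "1 \<in> c5_domain F"
        using one_nonzero_element 5 by (simp add: c5_domain_def Phi5_eq)
      ultimately show ?thesis unfolding 3 G5_def by force
    next
      case 4
      show ?thesis unfolding 4 by (rule c5_powi[of _ 0]) simp
    next
      case 5
      show ?thesis unfolding 5 by (rule c5_powi) (rule Phi5_root_powi)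
    qed
  qed
  have "c5 F a [^]\<^bsub>K2 F\<^esub> k \<in> G5 F" for k :: int
  proof -
    define i where "i = (k + 2) mod 5 - 2"
    have "k = i + 5 * ((k + 2) div 5)" unfolding i_def by (simp add: minus_mod_eq_mult_div [symmetric])
    then have "c5 F a [^]\<^bsub>K2 F\<^esub> k
        = c5 F a [^]\<^bsub>K2 F\<^esub> i \<otimes>\<^bsub>K2 F\<^esub> (c5 F a [^]\<^bsub>K2 F\<^esub> (5 :: int)) [^]\<^bsub>K2 F\<^esub> ((k + 2) div 5)"
      using c by (metis K.int_pow_mult K.int_pow_pow)
    also have "\<dots> = c5 F a [^]\<^bsub>K2 F\<^esub> i" using c by (simp add: c5_order)
    also have "\<dots> \<in> G5 F"
    proof (rule small)
      have "0 \<le> (k + 2) mod 5" "(k + 2) mod 5 < 5" by simp_all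
      then show "i \<in> {-2, -1, 0, 1, 2}" unfolding i_def by auto
    qed
    finally show ?thesis .
  qed
  then show ?thesis
    unfolding cyclotomic_subgroup_def
    using c K.generate_is_subgroup[of "{c5 F a}"] by (auto simp: K.generate_pow)
qed

end

end

section \<open>Discrete valuations and the tame symbol\<close>

text \<open>
  Integers have no value \<open>\<infinity>\<close> for 0, so the value at 0 is left unspecified and the axioms speak of nonzero
  elements.
\<close>

locale valued_field =
  fixes K :: "'a::field set" and v :: "'a \<Rightarrow> int"
  assumes one_mem: "1 \<in> K"
    and add_mem: "\<lbrakk>x \<in> K; y \<in> K\<rbrakk> \<Longrightarrow> x + y \<in> K"
    and minus_mem: "x \<in> K \<Longrightarrow> - x \<in> K"
    and mult_mem: "\<lbrakk>x \<in> K; y \<in> K\<rbrakk> \<Longrightarrow> x * y \<in> K"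
    and inverse_mem: "x \<in> K \<Longrightarrow> inverse x \<in> K"
    and v_mult: "\<lbrakk>x \<in> K; y \<in> K; x \<noteq> 0; y \<noteq> 0\<rbrakk> \<Longrightarrow> v (x * y) = v x + v y"
    and v_add: "\<lbrakk>x \<in> K; y \<in> K; x \<noteq> 0; y \<noteq> 0; x + y \<noteq> 0\<rbrakk> \<Longrightarrow> min (v x) (v y) \<le> v (x + y)"
begin

lemma diff_mem: "\<lbrakk>x \<in> K; y \<in> K\<rbrakk> \<Longrightarrow> x - y \<in> K"
  using add_mem[of x "- y"] minus_mem by simp

lemma v_one: "v 1 = 0"
  using v_mult[of 1 1] one_mem by simp

lemma v_minus: assumes "x \<in> K" shows "v (- x) = v x"
proof (cases "x = 0")
  case False
  have m: "- 1 \<in> K" by (simp add: minus_mem one_mem)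
  have "v (- 1) = 0" using v_mult[of "- 1" "- 1"] m v_one by simp
  then show ?thesis using v_mult[of "- 1" x] m assms False by simp
qed simp

lemma v_inverse: assumes "x \<in> K" "x \<noteq> 0" shows "v (inverse x) = - v x"
  using v_mult[of x "inverse x"] assms inverse_mem v_one by simp

lemma v_diff:
  "\<lbrakk>x \<in> K; y \<in> K; x \<noteq> 0; y \<noteq> 0; x \<noteq> y\<rbrakk> \<Longrightarrow> min (v x) (v y) \<le> v (x - y)"
  using v_add[of x "- y"] minus_mem v_minus by auto

lemma v_diff_eq:
  assumes "x \<in> K" "y \<in> K" "x \<noteq> 0" "y \<noteq> 0" "v x < v y"
  shows "v (x - y) = v x"
proof -
  have "x \<noteq> y" using assms by auto
  then show ?thesis
    using v_diff[of x y] v_add[of "x - y" y] assms diff_mem by force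
qed

text \<open>
  The kernel of reduction on the units of the valuation ring. The case \<open>u = 1\<close> is listed separately
  because \<open>v 0\<close> carries no information.
\<close>

definition principal_units :: "'a set"
  where "principal_units = {u \<in> K. u \<noteq> 0 \<and> (u = 1 \<or> 0 < v (u - 1))}"

lemma v_principal_unit:
  assumes "u \<in> principal_units" shows "v u = 0"
proof (cases "u = 1")
  case False
  then have u: "u \<in> K" "u \<noteq> 0" "0 < v (u - 1)" using assms by (auto simp: principal_units_def)
  have "v (1 - (1 - u)) = v 1"
    using u v_minus[of "u - 1"] False
    by (intro v_diff_eq) (auto simp: one_mem diff_mem v_one)
  then show ?thesis by (simp add: v_one)
qed (simp add: v_one)

lemma principal_units_mult:
  assumes "u \<in> principal_units" "w \<in> principal_units"
  shows "u * w \<in> principal_units"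
proof -
  consider "u = 1" | "w = 1" | "u * w = 1" | "u \<noteq> 1" "w \<noteq> 1" "u * w \<noteq> 1" by blast
  then show ?thesis
  proof cases
    case 4
    have m: "u \<in> K" "w \<in> K" "u \<noteq> 0" "w \<noteq> 0" "0 < v (u - 1)" "0 < v (w - 1)"
      using assms 4 by (auto simp: principal_units_def)
    have eq: "u * w - 1 = (u - 1) * w + (w - 1)" by (simp add: algebra_simps)
    have "min (v ((u - 1) * w)) (v (w - 1)) \<le> v (u * w - 1)"
      unfolding eq using 4 m by (intro v_add) (auto simp: mult_mem diff_mem one_mem simp flip: eq)
    moreover have "v ((u - 1) * w) = v (u - 1)"
      using v_mult[of "u - 1" w] v_principal_unit[OF assms(2)] m 4 by (simp add: diff_mem one_mem)
    ultimately show ?thesis using m by (auto simp: principal_units_def mult_mem)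
  qed (use assms mult_mem one_mem in \<open>auto simp: principal_units_def\<close>)
qed

lemma principal_units_inverse:
  assumes "u \<in> principal_units"
  shows "inverse u \<in> principal_units"
proof (cases "u = 1")
  case False
  have m: "u \<in> K" "u \<noteq> 0" "0 < v (u - 1)"
    using assms False by (auto simp: principal_units_def)
  have "inverse u - 1 = - ((u - 1) * inverse u)" using m by (simp add: field_simps)
  then have "v (inverse u - 1) = v ((u - 1) * inverse u)"
    using v_minus[of "(u - 1) * inverse u"] m by (simp add: mult_mem diff_mem one_mem inverse_mem)
  also have "\<dots> = v (u - 1)"
    using v_mult[of "u - 1" "inverse u"] v_inverse[of u] v_principal_unit[OF assms] m False
    by (simp add: diff_mem one_mem inverse_mem)
  finally show ?thesis using m by (simp add: principal_units_def inverse_mem)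
qed (use assms in simp)

lemma principal_units_powi:
  assumes "u \<in> principal_units"
  shows "u powi n \<in> principal_units"
proof -
  have nat: "w ^ k \<in> principal_units" if "w \<in> principal_units" for w and k :: nat
    by (induction k) (use that principal_units_mult one_mem in \<open>auto simp: principal_units_def\<close>)
  show ?thesis
    using nat[OF assms] nat[OF principal_units_inverse[OF assms]] by (simp add: power_int_def)
qed

text \<open>
  The tame symbol before reduction to the residue field. At this level it is exactly
  bimultiplicative; only the Steinberg relation needs the passage to the quotient by
  \<open>principal_units\<close>.
\<close>

definition tame :: "'a \<Rightarrow> 'a \<Rightarrow> 'a"
  where "tame a b = (- 1) powi (v a * v b) * a powi v b / b powi v a"

lemma tame_nonzero: "\<lbrakk>a \<noteq> 0; b \<noteq> 0\<rbrakk> \<Longrightarrow> tame a b \<noteq> 0"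
  by (simp add: tame_def)

lemma tame_mult_left:
  assumes "a \<in> K" "b \<in> K" "a \<noteq> 0" "b \<noteq> 0" "c \<noteq> 0"
  shows "tame (a * b) c = tame a c * tame b c"
  using assms by (simp add: tame_def v_mult power_int_add power_int_mult_distrib distrib_right)

lemma tame_mult_right:
  assumes "b \<in> K" "c \<in> K" "a \<noteq> 0" "b \<noteq> 0" "c \<noteq> 0"
  shows "tame a (b * c) = tame a b * tame a c"
  using assms by (simp add: tame_def v_mult power_int_add power_int_mult_distrib distrib_left)

text \<open>
  If one of \<open>a\<close>, \<open>1 - a\<close> has positive value, the other is a principal unit and has value 0; if both
  values vanish, the symbol is 1. In the remaining case both values equal some \<open>n < 0\<close>, the sign is
  \<open>(-1)\<^sup>n\<close>, and the symbol is the \<open>n\<close>-th power of \<open>a / (a - 1)\<close>, which differs from 1 by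
  \<open>1 / (a - 1)\<close>, an element of positive value.
\<close>

lemma tame_steinberg:
  assumes a: "a \<in> K" "a \<noteq> 0" "a \<noteq> 1"
  shows "tame a (1 - a) \<in> principal_units"
proof -
  have b: "1 - a \<in> K" "1 - a \<noteq> 0" using a by (auto simp: diff_mem one_mem)
  consider "0 < v a" | "v a = 0" | "v a < 0" by linarith
  then show ?thesis
  proof cases
    case 1
    have "v (1 - a) = 0" using v_diff_eq[of 1 a] 1 a by (simp add: one_mem v_one)
    moreover have "1 - a \<in> principal_units"
      using 1 a b v_minus[of a] by (simp add: principal_units_def)
    ultimately show ?thesis
      using principal_units_inverse[OF principal_units_powi[of "1 - a" "v a"]] 
      by (simp add: tame_def field_simps)
  next
    case 2
    have ge: "0 \<le> v (1 - a)" using v_diff[of 1 a] 2 a by (simp add: one_mem v_one)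
    have "a powi v (1 - a) \<in> principal_units"
    proof (cases "v (1 - a) = 0")
      case False
      have "v (a - 1) = v (1 - a)" using v_minus[OF b(1)] by simp
      then have "a \<in> principal_units" using False ge a by (simp add: principal_units_def)
      then show ?thesis by (rule principal_units_powi)
    qed (simp add: principal_units_def one_mem)
    then show ?thesis using 2 by (simp add: tame_def)
  next
    case 3
    have "v (a - 1) = v a" using v_diff_eq[of a 1] 3 a by (simp add: one_mem v_one)
    then have vb: "v (1 - a) = v a" using v_minus[OF b(1)] by simp
    define u where "u = a / (a - 1)"
    have "u - 1 = inverse (a - 1)" using a by (simp add: u_def field_simps)
    then have "0 < v (u - 1)"
      using v_inverse[of "a - 1"] \<open>v (a - 1) = v a\<close> 3 a by (simp add: diff_mem one_mem)
    moreover have "u \<in> K" using a mult_mem[of a "inverse (a - 1)"] 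
      by (simp add: u_def inverse_mem diff_mem one_mem divide_inverse)
    ultimately have "u \<in> principal_units" using a by (auto simp: principal_units_def u_def)
    moreover have "tame a (1 - a) = u powi v a"
    proof -
      have "(- 1 :: 'a) powi (v a * v a) = (- 1) powi v a"
        by (simp add: power_int_minus_left)
      moreover have "u = - 1 * a / (1 - a)" using a by (simp add: u_def field_simps)
      ultimately show ?thesis by (simp add: tame_def vb power_int_divide_distrib power_int_mult_distrib del: mult_minus_left mult_minus1)
    qed
    ultimately show ?thesis by (simp add: principal_units_powi)
  qed
qed

end

text \<open>
  A subring with a prime element \<open>p\<close> such that no nonzero element is divisible by all powers of \<open>p\<close>.
  Every nonzero element is then a power of \<open>p\<close> times an element prime to \<open>p\<close>, which yields the
  \<open>p\<close>-adic valuation on the field of fractions.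
\<close>

locale separated_prime =
  fixes R :: "'a::field set" and p :: 'a
  assumes one_mem: "1 \<in> R"
    and add_mem: "\<lbrakk>x \<in> R; y \<in> R\<rbrakk> \<Longrightarrow> x + y \<in> R"
    and minus_mem: "x \<in> R \<Longrightarrow> - x \<in> R"
    and mult_mem: "\<lbrakk>x \<in> R; y \<in> R\<rbrakk> \<Longrightarrow> x * y \<in> R"
    and p_mem: "p \<in> R" and p_nonzero: "p \<noteq> 0"
    and not_unit: "1 \<notin> (*) p ` R"
    and prime: "\<lbrakk>x \<in> R; y \<in> R; x * y \<in> (*) p ` R\<rbrakk> \<Longrightarrow> x \<in> (*) p ` R \<or> y \<in> (*) p ` R"
    and separated: "\<lbrakk>x \<in> R; \<And>n. x \<in> (*) (p ^ n) ` R\<rbrakk> \<Longrightarrow> x = 0"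
begin

definition fractions :: "'a set"
  where "fractions = {r / s | r s. r \<in> R \<and> s \<in> R \<and> s \<noteq> 0}"

definition prime_to_p :: "'a set"
  where "prime_to_p = R - (*) p ` R"

lemma zero_mem: "0 \<in> R"
  using add_mem[OF one_mem minus_mem[OF one_mem]] by simp

lemma p_power_mem: "p ^ n \<in> R"
  by (induction n) (auto simp: one_mem mult_mem p_mem)

lemma prime_to_p_mem: "x \<in> prime_to_p \<Longrightarrow> x \<in> R"
  by (simp add: prime_to_p_def)

lemma prime_to_p_nonzero: "x \<in> prime_to_p \<Longrightarrow> x \<noteq> 0"
  using zero_mem by (force simp: prime_to_p_def)

lemma prime_to_p_mult: "\<lbrakk>x \<in> prime_to_p; y \<in> prime_to_p\<rbrakk> \<Longrightarrow> x * y \<in> prime_to_p"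
  using prime[of x y] mult_mem by (auto simp: prime_to_p_def)

lemma one_prime_to_p: "1 \<in> prime_to_p"
  using not_unit by (simp add: prime_to_p_def one_mem)

lemma p_adic_decomposition:
  assumes "x \<in> R" "x \<noteq> 0"
  obtains n s where "s \<in> prime_to_p" "x = p ^ n * s"
proof -
  obtain m where m: "x \<notin> (*) (p ^ m) ` R" using separated assms by blast
  define k where "k = (LEAST m. x \<notin> (*) (p ^ m) ` R)"
  have k: "x \<notin> (*) (p ^ k) ` R" unfolding k_def by (rule LeastI[of _ m]) (rule m)
  have "k \<noteq> 0" using k assms by (auto intro!: notI)
  then obtain n where n: "k = Suc n" by (cases k) auto
  have "x \<in> (*) (p ^ n) ` R" using not_less_Least[of n "\<lambda>m. x \<notin> (*) (p ^ m) ` R"] n k_def by auto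
  then obtain s where s: "s \<in> R" "x = p ^ n * s" by auto
  have "s \<notin> (*) p ` R" using k s n by (auto simp: image_iff mult_ac)
  then show ?thesis using that s by (auto simp: prime_to_p_def)
qed

text \<open>
  The \<open>p\<close>-adic value as a relation: \<open>x\<close> is \<open>p\<^sup>n\<close> times a unit of the localization at \<open>p\<close>.
\<close>

definition has_value :: "'a \<Rightarrow> int \<Rightarrow> bool"
  where "has_value x n \<longleftrightarrow> (\<exists>r\<in>prime_to_p. \<exists>s\<in>prime_to_p. x = p powi n * r / s)"

lemma has_value_le:
  assumes "has_value x m" "has_value x n" shows "m \<le> n"
proof (rule ccontr)
  assume "\<not> m \<le> n"
  then obtain k where k: "m = n + 1 + int k" using zless_iff_Suc_zadd[of n m] by auto
  obtain r s r' s' where *: "r \<in> prime_to_p" "s \<in> prime_to_p" "r' \<in> prime_to_p" "s' \<in> prime_to_p"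
    "p powi m * r / s = p powi n * r' / s'"
    using assms by (auto simp: has_value_def)
  have "p powi n * p * p ^ k * r / s = p powi n * r' / s'"
    using *(5) p_nonzero by (simp add: k power_int_add)
  then have "r' * s = p * (p ^ k * r * s')"
    using *(1-4)[THEN prime_to_p_nonzero] p_nonzero by (simp add: field_simps)
  moreover have "p ^ k * r * s' \<in> R" by (intro mult_mem p_power_mem prime_to_p_mem *)
  ultimately have "r' * s \<notin> prime_to_p" by (auto simp: prime_to_p_def)
  then show False using prime_to_p_mult * by blast
qed

definition val :: "'a \<Rightarrow> int"
  where "val x = (THE n. has_value x n)"

lemma val_eqI: "has_value x n \<Longrightarrow> val x = n"
  unfolding val_def using has_value_le by (blast intro: order_antisym)

lemma has_value_val:
  assumes "x \<in> fractions" "x \<noteq> 0" shows "has_value x (val x)"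
proof -
  obtain r s where rs: "r \<in> R" "s \<in> R" "s \<noteq> 0" "x = r / s" using assms by (auto simp: fractions_def)
  then have "r \<noteq> 0" using assms by auto
  obtain m r' where r': "r' \<in> prime_to_p" "r = p ^ m * r'" using p_adic_decomposition rs \<open>r \<noteq> 0\<close> by blast
  obtain n s' where s': "s' \<in> prime_to_p" "s = p ^ n * s'" using p_adic_decomposition rs by blast
  have "x = p powi (int m - int n) * r' / s'"
    using rs r' s' p_nonzero by (simp add: power_int_diff field_simps)
  then have "has_value x (int m - int n)" using r' s' by (auto simp: has_value_def)
  then show ?thesis using val_eqI by metis
qed

lemma has_value_mult:
  assumes "has_value x m" "has_value y n" shows "has_value (x * y) (m + n)"
proof -
  obtain r s r' s' where *: "r \<in> prime_to_p" "s \<in> prime_to_p" "r' \<in> prime_to_p" "s' \<in> prime_to_p"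
    "x = p powi m * r / s" "y = p powi n * r' / s'"
    using assms by (auto simp: has_value_def)
  have "x * y = p powi (m + n) * (r * r') / (s * s')"
    using *(5,6) p_nonzero by (simp add: power_int_add field_simps)
  then show ?thesis unfolding has_value_def using * prime_to_p_mult by blast
qed

lemma val_add_ge:
  assumes "has_value x m" "has_value y n" "x + y \<noteq> 0" "m \<le> n"
  shows "m \<le> val (x + y)"
proof -
  obtain r s r' s' where *: "r \<in> prime_to_p" "s \<in> prime_to_p" "r' \<in> prime_to_p" "s' \<in> prime_to_p"
    "x = p powi m * r / s" "y = p powi n * r' / s'"
    using assms by (auto simp: has_value_def)
  obtain k where k: "n = m + int k" using zle_iff_zadd[of m n] assms(4) by auto
  define w where "w = r * s' + p ^ k * r' * s"
  have eq: "x + y = p powi m * w / (s * s')"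
    using *(1-4)[THEN prime_to_p_nonzero] p_nonzero
    by (simp add: *(5,6) k w_def power_int_add field_simps)
  have "w \<in> R" unfolding w_def by (intro add_mem mult_mem p_power_mem prime_to_p_mem *)
  moreover have "w \<noteq> 0" using assms(3) eq by auto
  ultimately obtain l w' where w': "w' \<in> prime_to_p" "w = p ^ l * w'" using p_adic_decomposition by blast
  have "x + y = p powi (m + int l) * w' / (s * s')"
    using eq w' p_nonzero by (simp add: power_int_add)
  then have "has_value (x + y) (m + int l)"
    unfolding has_value_def using * w' prime_to_p_mult by blast
  then show ?thesis using val_eqI by fastforce
qed

lemma fractions_incl: "x \<in> R \<Longrightarrow> x \<in> fractions"
  unfolding fractions_def using one_mem by force

lemma fractionsE:
  assumes "x \<in> fractions"
  obtains r s where "r \<in> R" "s \<in> R" "s \<noteq> 0" "x = r / s"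
  using assms by (auto simp: fractions_def)

lemma val_prime_to_p: "x \<in> prime_to_p \<Longrightarrow> val x = 0"
  by (rule val_eqI) (force simp: has_value_def intro: bexI[of _ x] bexI[OF _ one_prime_to_p])

lemma val_p: "val p = 1"
  by (rule val_eqI) (force simp: has_value_def intro: bexI[OF _ one_prime_to_p])

sublocale valued_field fractions val
proof
  show "1 \<in> fractions" by (simp add: fractions_incl one_mem)
  show "x + y \<in> fractions" if xy: "x \<in> fractions" "y \<in> fractions" for x y
  proof -
    obtain r s where x: "r \<in> R" "s \<in> R" "s \<noteq> 0" "x = r / s"
      using xy(1) by (rule fractionsE)
    obtain r' s' where y: "r' \<in> R" "s' \<in> R" "s' \<noteq> 0" "y = r' / s'"
      using xy(2) by (rule fractionsE)
    note * = x y
    have "x + y = (r * s' + r' * s) / (s * s')" using * by (simp add: field_simps)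
    moreover have "r * s' + r' * s \<in> R" "s * s' \<in> R" "s * s' \<noteq> 0" using * by (auto simp: add_mem mult_mem)
    ultimately show ?thesis unfolding fractions_def by blast
  qed
  show "- x \<in> fractions" if x: "x \<in> fractions" for x
  proof -
    obtain r s where *: "r \<in> R" "s \<in> R" "s \<noteq> 0" "x = r / s"
      using x by (rule fractionsE)
    then have "- x = (- r) / s" by simp
    then show ?thesis unfolding fractions_def using * minus_mem by blast
  qed
  show "x * y \<in> fractions" if xy: "x \<in> fractions" "y \<in> fractions" for x y
  proof -
    obtain r s where x: "r \<in> R" "s \<in> R" "s \<noteq> 0" "x = r / s"
      using xy(1) by (rule fractionsE)
    obtain r' s' where y: "r' \<in> R" "s' \<in> R" "s' \<noteq> 0" "y = r' / s'"
      using xy(2) by (rule fractionsE)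
    note * = x y
    have "x * y = (r * r') / (s * s')" using * by simp
    moreover have "r * r' \<in> R" "s * s' \<in> R" "s * s' \<noteq> 0" using * by (auto simp: mult_mem)
    ultimately show ?thesis unfolding fractions_def by blast
  qed
  show "inverse x \<in> fractions" if x: "x \<in> fractions" for x
  proof (cases "x = 0")
    case False
    obtain r s where *: "r \<in> R" "s \<in> R" "s \<noteq> 0" "x = r / s"
      using x by (rule fractionsE)
    then have "inverse x = s / r" "r \<noteq> 0" using False by auto
    then show ?thesis unfolding fractions_def using * by blast
  qed (use x in simp)
  show "val (x * y) = val x + val y" if "x \<in> fractions" "y \<in> fractions" "x \<noteq> 0" "y \<noteq> 0" for x y
    using that by (intro val_eqI has_value_mult has_value_val)
  show "min (val x) (val y) \<le> val (x + y)"
    if "x \<in> fractions" "y \<in> fractions" "x \<noteq> 0" "y \<noteq> 0" "x + y \<noteq> 0" for x y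
    using val_add_ge[of x "val x" y "val y"] val_add_ge[of y "val y" x "val x"] has_value_val that
    by (cases "val x \<le> val y") (auto simp: add.commute)
qed

end

section \<open>A prime of norm 11\<close>

text \<open>
  The norm of \<open>x + y\<alpha> + z\<alpha>\<^sup>2\<close>, that is, the determinant of multiplication by this element on the basis
  \<open>1, \<alpha>, \<alpha>\<^sup>2\<close>.
\<close>

definition norm_form :: "int \<Rightarrow> int \<Rightarrow> int \<Rightarrow> int"
  where "norm_form x y z =
    x * (x * (x + y + z) + z * (y + z)) + z * (z ^ 2 + y * (x + y + z)) - (y + z) * (y * (y + z) - x * z)"

text \<open>
  The cubic is irreducible modulo 2, so the norm form is anisotropic over the field with two elements.
\<close>

lemma norm_form_even: "even (norm_form x y z) \<Longrightarrow> even x \<and> even y \<and> even z"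
  by (cases "even x"; cases "even y"; cases "even z") (auto simp: norm_form_def)

text \<open>
  Infinite descent: a zero has even coordinates, and halving them gives another zero. In
  particular the cubic is irreducible over the rationals.
\<close>

lemma norm_form_eq_0: "norm_form x y z = 0 \<Longrightarrow> x = 0 \<and> y = 0 \<and> z = 0"
proof (induction "nat (\<bar>x\<bar> + \<bar>y\<bar> + \<bar>z\<bar>)" arbitrary: x y z rule: less_induct)
  case less
  have "even x \<and> even y \<and> even z" by (rule norm_form_even) (simp add: less.prems)
  then obtain x' y' z' where e: "x = 2 * x'" "y = 2 * y'" "z = 2 * z'" by (auto elim!: evenE)
  have "norm_form x y z = 8 * norm_form x' y' z'"
    unfolding e norm_form_def by (simp add: algebra_simps power2_eq_square)
  then have 0: "norm_form x' y' z' = 0" using less.prems by simp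
  show ?case
  proof (rule ccontr)
    assume nz: "\<not> ?thesis"
    then have "nat (\<bar>x'\<bar> + \<bar>y'\<bar> + \<bar>z'\<bar>) < nat (\<bar>x\<bar> + \<bar>y\<bar> + \<bar>z\<bar>)" using e by auto
    from less.hyps[OF this 0] show False using nz e by simp
  qed
qed

text \<open>
  The nonzero squares modulo 11 are 1, 3, 4, 5, 9; no two of them add up to 0, as -1 is not a square.
  Hence the sum of two squares is anisotropic modulo 11.
\<close>

lemma square_mod_11:
  fixes k :: int
  shows "k mod 11 = 0 \<and> k ^ 2 mod 11 = 0 \<or> k ^ 2 mod 11 \<in> {1, 3, 4, 5, 9}"
proof -
  have "k ^ 2 mod 11 = (k mod 11) ^ 2 mod 11" by (metis power_mod)
  moreover have "0 \<le> k mod 11" "k mod 11 < 11" by simp_all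
  then have "k mod 11 = 0 \<or> k mod 11 = 1 \<or> k mod 11 = 2 \<or> k mod 11 = 3 \<or> k mod 11 = 4 \<or>
    k mod 11 = 5 \<or> k mod 11 = 6 \<or> k mod 11 = 7 \<or> k mod 11 = 8 \<or> k mod 11 = 9 \<or> k mod 11 = 10"
    by presburger
  ultimately show ?thesis by (elim disjE) simp_all
qed

lemma sum_squares_mod_11:
  fixes k l :: int
  assumes "11 dvd k ^ 2 + l ^ 2"
  shows "11 dvd k \<and> 11 dvd l"
proof -
  have "(k ^ 2 mod 11 + l ^ 2 mod 11) mod 11 = 0" using assms by (simp add: mod_add_eq)
  then have "k mod 11 = 0 \<and> l mod 11 = 0"
    using square_mod_11[of k] square_mod_11[of l] by (elim disjE conjE) (simp_all, auto)
  then show ?thesis by (simp add: dvd_eq_mod_eq_0)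
qed

locale cubic_root =
  fixes \<alpha> :: "'a::field_char_0"
  assumes root: "\<alpha> ^ 3 = \<alpha> ^ 2 - 1"
begin

definition elt :: "int \<Rightarrow> int \<Rightarrow> int \<Rightarrow> 'a"
  where "elt x y z = of_int x + of_int y * \<alpha> + of_int z * \<alpha> ^ 2"

definition A :: "'a set"
  where "A = {elt x y z | x y z. True}"

definition \<pi> :: 'a
  where "\<pi> = 3 * \<alpha> ^ 2 - 1"

definition P :: "'a set"
  where "P = (*) \<pi> ` A"

lemma elt_add: "elt x y z + elt x' y' z' = elt (x + x') (y + y') (z + z')"
  by (simp add: elt_def algebra_simps)

lemma elt_minus: "- elt x y z = elt (- x) (- y) (- z)"
  by (simp add: elt_def)

lemma elt_mult:
  "elt x y z * elt x' y' z' =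
    elt (x * x' - z * y' - (y + z) * z') (y * x' + x * y' - z * z')
      (z * x' + (y + z) * y' + (x + y + z) * z')"
  unfolding elt_def of_int_add of_int_mult of_int_diff using root by Groebner_Basis.algebra

lemma \<pi>_elt: "\<pi> = elt (- 1) 0 3"
  by (simp add: \<pi>_def elt_def)

text \<open>
  The second factor is the adjugate, the product of the other two conjugates; its coordinates are the
  cofactors of the multiplication matrix.
\<close>

lemma elt_norm_form:
  "elt x y z * elt (x * (x + y + z) + z * (y + z)) (- (z ^ 2 + y * (x + y + z))) (y * (y + z) - x * z)
    = of_int (norm_form x y z)"
  unfolding elt_def norm_form_def of_int_add of_int_mult of_int_diff of_int_minus of_int_power
  using root by Groebner_Basis.algebra

lemma elt_eq_0: "elt x y z = 0 \<Longrightarrow> x = 0 \<and> y = 0 \<and> z = 0"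
  using elt_norm_form[of x y z] norm_form_eq_0[of x y z] by simp

lemma elt_inj: "elt x y z = elt x' y' z' \<Longrightarrow> x = x' \<and> y = y' \<and> z = z'"
  using elt_eq_0[of "x - x'" "y - y'" "z - z'"] by (simp add: elt_def algebra_simps)

lemma elt_A [simp]: "elt x y z \<in> A"
  unfolding A_def by blast

lemma A_E:
  assumes "r \<in> A" obtains x y z where "r = elt x y z"
  using assms unfolding A_def by blast

lemma A_add: "\<lbrakk>r \<in> A; s \<in> A\<rbrakk> \<Longrightarrow> r + s \<in> A"
  by (auto elim!: A_E simp: elt_add)

lemma A_minus: "r \<in> A \<Longrightarrow> - r \<in> A"
  by (auto elim!: A_E simp: elt_minus)

lemma A_diff: "\<lbrakk>r \<in> A; s \<in> A\<rbrakk> \<Longrightarrow> r - s \<in> A"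
  using A_add[of r "- s"] A_minus by simp

lemma A_mult: "\<lbrakk>r \<in> A; s \<in> A\<rbrakk> \<Longrightarrow> r * s \<in> A"
  by (auto elim!: A_E simp: elt_mult)

lemma of_int_A: "of_int k \<in> A"
  unfolding A_def elt_def by (rule CollectI, rule exI[of _ k], rule exI[of _ 0], rule exI[of _ 0]) simp

lemma A_simps [simp]: "0 \<in> A" "1 \<in> A" "numeral n \<in> A"
  using of_int_A[of 0] of_int_A[of 1] of_int_A[of "numeral n"] by simp_all

lemma \<alpha>_A [simp]: "\<alpha> \<in> A"
  unfolding A_def elt_def by (rule CollectI, rule exI[of _ 0], rule exI[of _ 1], rule exI[of _ 0]) simp

lemma A_power: "r \<in> A \<Longrightarrow> r ^ n \<in> A"
  by (induction n) (auto simp: A_mult)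

lemma \<pi>_A [simp]: "\<pi> \<in> A"
  by (simp add: \<pi>_def A_diff A_mult A_power)

lemma \<pi>_nonzero: "\<pi> \<noteq> 0"
  using elt_eq_0[of "- 1" 0 3] by (auto simp: \<pi>_elt)

lemma P_subset: "P \<subseteq> A"
  by (auto simp: P_def A_mult)

lemma P_add: "\<lbrakk>r \<in> P; s \<in> P\<rbrakk> \<Longrightarrow> r + s \<in> P"
  unfolding P_def using A_add by (auto simp flip: distrib_left)

lemma P_mult: "\<lbrakk>r \<in> A; s \<in> P\<rbrakk> \<Longrightarrow> r * s \<in> P"
  unfolding P_def using A_mult by (auto simp: mult.left_commute[of r])

lemma P_minus: "r \<in> P \<Longrightarrow> - r \<in> P"
  using P_mult[of "- 1" r] A_minus[of 1] by simp

lemma elt_\<pi>_mult: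
  assumes "elt x y z = \<pi> * elt x' y' z'"
  shows "x = - x' - 3 * y' - 3 * z'" "y = - y' - 3 * z'" "z = 3 * x' + 3 * y' + 2 * z'"
  using assms unfolding \<pi>_elt elt_mult by (auto dest!: elt_inj)

text \<open>
  The ideal generated by \<open>\<pi>\<close> is the kernel of the reduction \<open>\<alpha> \<mapsto> 9\<close> modulo 11 (note that
  \<open>9\<^sup>2 = 4\<close> modulo 11). For the converse, \<open>\<pi> (7 - 9\<alpha> + 3\<alpha>\<^sup>2) = 11\<close>, so the quotient by \<open>\<pi>\<close> is found by
  multiplying with \<open>7 - 9\<alpha> + 3\<alpha>\<^sup>2\<close> and dividing the coordinates by 11.
\<close>

lemma elt_P_iff: "elt x y z \<in> P \<longleftrightarrow> 11 dvd x + 9 * y + 4 * z"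
proof
  assume "elt x y z \<in> P"
  then obtain x' y' z' where "elt x y z = \<pi> * elt x' y' z'" by (auto simp: P_def elim!: A_E)
  from elt_\<pi>_mult[OF this] have "x + 9 * y + 4 * z = 11 * (x' - 2 * z')" by simp
  then show "11 dvd x + 9 * y + 4 * z" by simp
next
  assume "11 dvd x + 9 * y + 4 * z"
  then obtain k where "x = 11 * k - 9 * y - 4 * z" by (auto elim!: dvdE simp: algebra_simps)
  then have "elt x y z = \<pi> * elt (7 * k - 6 * y - 2 * z) (- 9 * k + 8 * y + 3 * z) (3 * k - 3 * y - z)"
    unfolding \<pi>_elt elt_mult by (intro arg_cong3[of _ _ _ _ _ _ elt]) auto
  then show "elt x y z \<in> P" by (auto simp: P_def)
qed

lemma of_int_P_iff: "of_int k \<in> P \<longleftrightarrow> 11 dvd k"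
  using elt_P_iff[of k 0 0] by (simp add: elt_def)

text \<open>
  Reduction modulo \<open>\<pi>\<close>, as a relation between \<open>A\<close> and the integers: every element of \<open>A\<close> is congruent
  to an integer, and divisibility by \<open>\<pi>\<close> becomes divisibility of that integer by 11. Later computations
  in the residue field are thereby computations with integers.
\<close>

definition cong_P :: "'a \<Rightarrow> int \<Rightarrow> bool"
  where "cong_P r k \<longleftrightarrow> r - of_int k \<in> P"

lemma cong_P_ex: assumes "r \<in> A" shows "\<exists>k. cong_P r k"
proof -
  obtain x y z where r: "r = elt x y z" using assms by (auto elim: A_E)
  have "r - of_int (x + 9 * y + 4 * z) = elt (- 9 * y - 4 * z) y z"
    by (simp add: r elt_def)
  also have "\<dots> \<in> P" by (simp add: elt_P_iff)
  finally show ?thesis unfolding cong_P_def ..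
qed

lemma cong_P_A: "cong_P r k \<Longrightarrow> r \<in> A"
  using P_subset A_add[of "r - of_int k" "of_int k"] of_int_A by (auto simp: cong_P_def)

lemma cong_P_iff: assumes "cong_P r k" shows "r \<in> P \<longleftrightarrow> 11 dvd k"
proof
  assume "r \<in> P"
  then have "r + - (r - of_int k) \<in> P" using assms by (intro P_add P_minus) (auto simp: cong_P_def)
  then show "11 dvd k" by (simp add: of_int_P_iff)
next
  assume "11 dvd k"
  then have "(r - of_int k) + of_int k \<in> P" using assms by (intro P_add) (auto simp: cong_P_def of_int_P_iff)
  then show "r \<in> P" by simp
qed

lemma cong_P_int: "cong_P (of_int k) k" "cong_P 0 0" "cong_P 1 1" "cong_P (numeral n) (numeral n)"
  using of_int_P_iff[of 0] by (simp_all add: cong_P_def)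

lemma cong_P_\<alpha>: "cong_P \<alpha> 9"
  using elt_P_iff[of "- 9" 1 0] by (simp add: elt_def cong_P_def)

lemma cong_P_add: "\<lbrakk>cong_P r k; cong_P s l\<rbrakk> \<Longrightarrow> cong_P (r + s) (k + l)"
  using P_add[of "r - of_int k" "s - of_int l"] by (simp add: cong_P_def algebra_simps)

lemma cong_P_minus: "cong_P r k \<Longrightarrow> cong_P (- r) (- k)"
  using P_minus[of "r - of_int k"] by (simp add: cong_P_def)

lemma cong_P_diff: "\<lbrakk>cong_P r k; cong_P s l\<rbrakk> \<Longrightarrow> cong_P (r - s) (k - l)"
  using cong_P_add[of r k "- s" "- l"] cong_P_minus by simp

lemma cong_P_mult: assumes "cong_P r k" "cong_P s l" shows "cong_P (r * s) (k * l)"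
proof -
  have "s * (r - of_int k) + of_int k * (s - of_int l) \<in> P"
    using assms cong_P_A of_int_A by (intro P_add P_mult) (auto simp: cong_P_def)
  then show ?thesis by (simp add: cong_P_def algebra_simps)
qed

lemma cong_P_power: "cong_P r k \<Longrightarrow> cong_P (r ^ n) (k ^ n)"
  by (induction n) (auto simp: cong_P_int cong_P_mult)

lemmas cong_P_intros = cong_P_int cong_P_\<alpha> cong_P_add cong_P_diff cong_P_mult cong_P_power

lemma P_prime: assumes "r \<in> A" "s \<in> A" "r * s \<in> P" shows "r \<in> P \<or> s \<in> P"
proof -
  obtain k l where "cong_P r k" "cong_P s l" using assms cong_P_ex by blast
  moreover have "prime (11 :: int)" by simp
  ultimately show ?thesis
    using assms(3) cong_P_iff cong_P_mult prime_dvd_mult_iff by metis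
qed

text \<open>
  The norm is multiplicative and \<open>\<pi>\<close> has norm 11.
\<close>

lemma norm_form_\<pi>_power:
  assumes "elt x y z \<in> (*) (\<pi> ^ n) ` A" shows "11 ^ n dvd norm_form x y z"
  using assms
proof (induction n arbitrary: x y z)
  case (Suc n)
  then obtain s where s: "s \<in> A" "elt x y z = \<pi> * (\<pi> ^ n * s)" by (auto simp: mult.assoc)
  have "\<pi> ^ n * s \<in> A" using s by (simp add: A_mult A_power)
  then obtain x' y' z' where e: "\<pi> ^ n * s = elt x' y' z'" by (rule A_E)
  then have "11 ^ n dvd norm_form x' y' z'" using s by (intro Suc.IH) (metis imageI)
  moreover have "norm_form x y z = 11 * norm_form x' y' z'"
    unfolding elt_\<pi>_mult[OF s(2)[unfolded e]] norm_form_def by Groebner_Basis.algebra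
  ultimately show ?case by simp
qed simp

lemma A_separated:
  assumes "r \<in> A" "\<And>n. r \<in> (*) (\<pi> ^ n) ` A" shows "r = 0"
proof -
  obtain x y z where r: "r = elt x y z" using assms by (auto elim: A_E)
  have dvd: "11 ^ n dvd norm_form x y z" for n using norm_form_\<pi>_power assms(2) r by blast
  have "norm_form x y z = 0"
  proof (rule ccontr)
    assume nz: "norm_form x y z \<noteq> 0"
    define n where "n = nat \<bar>norm_form x y z\<bar>"
    have "11 ^ n \<le> \<bar>norm_form x y z\<bar>" using dvd_imp_le_int[OF nz dvd[of n]] by simp
    moreover have "int n < 11 ^ n" 
      using of_nat_less_two_power[of n, where 'a = int] power_mono[of 2 "11 :: int" n] by linarith
    ultimately show False unfolding n_def by simp
  qed
  then show ?thesis using norm_form_eq_0[of x y z] by (simp add: r elt_def)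
qed

end

section \<open>The prime in the splitting field\<close>

text \<open>
  Describing the roots by Vieta's formulas keeps the three of them interchangeable.
\<close>

locale cubic_roots =
  fixes \<alpha> \<beta> \<gamma> :: "'a::field_char_0"
  assumes e1: "\<alpha> + \<beta> + \<gamma> = 1"
    and e2: "\<alpha> * \<beta> + \<beta> * \<gamma> + \<gamma> * \<alpha> = 0"
    and e3: "\<alpha> * \<beta> * \<gamma> = - 1"
begin

sublocale cubic_root \<alpha>
proof
  show "\<alpha> ^ 3 = \<alpha> ^ 2 - 1" using e1 e2 e3 by Groebner_Basis.algebra
qed

lemma \<gamma>_eq: "\<gamma> = 1 - \<alpha> - \<beta>"
  using e1 by (simp add: algebra_simps)

lemma \<beta>_square: "\<beta> ^ 2 = (1 - \<alpha>) * \<beta> - (\<alpha> ^ 2 - \<alpha>)"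
  using e1 e2 by Groebner_Basis.algebra

text \<open>
  The relative norm from \<open>\<int>[\<alpha>, \<beta>]\<close> to \<open>\<int>[\<alpha>]\<close>.
\<close>

definition Q :: "'a \<Rightarrow> 'a \<Rightarrow> 'a"
  where "Q x y = x ^ 2 + x * y * (1 - \<alpha>) + y ^ 2 * (\<alpha> ^ 2 - \<alpha>)"

lemma Q_factor: "(x + y * \<beta>) * (x + y * \<gamma>) = Q x y"
  unfolding Q_def \<gamma>_eq using \<beta>_square by Groebner_Basis.algebra

lemma Q_A: "\<lbrakk>x \<in> A; y \<in> A\<rbrakk> \<Longrightarrow> Q x y \<in> A"
  unfolding Q_def by (intro A_add A_mult A_diff A_power \<alpha>_A A_simps)

text \<open>
  Modulo \<open>\<pi>\<close> the norm form is \<open>k\<^sup>2 - 8kl + 72l\<^sup>2\<close>, which is \<open>(k - 4l)\<^sup>2 + l\<^sup>2\<close> modulo 11. Its anisotropy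
  says that \<open>\<pi>\<close> is inert in the quadratic extension generated by \<open>\<beta>\<close>.
\<close>

lemma Q_anisotropic:
  assumes "x \<in> A" "y \<in> A" "Q x y \<in> P"
  shows "x \<in> P \<and> y \<in> P"
proof -
  obtain k l where kl: "cong_P x k" "cong_P y l" using assms cong_P_ex by blast
  have "cong_P (Q x y) (k ^ 2 + k * l * (1 - 9) + l ^ 2 * (9 ^ 2 - 9))"
    unfolding Q_def by (intro cong_P_intros kl)
  then have "11 dvd k ^ 2 + k * l * (1 - 9) + l ^ 2 * (9 ^ 2 - 9)"
    using assms(3) cong_P_iff by blast
  moreover have "k ^ 2 + k * l * (1 - 9) + l ^ 2 * (9 ^ 2 - 9) = ((k - 4 * l) ^ 2 + l ^ 2) + 11 * (5 * l ^ 2)"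
    by (simp add: power2_eq_square algebra_simps)
  ultimately have "11 dvd (k - 4 * l) ^ 2 + l ^ 2"
    by (metis dvd_add_left_iff dvd_triv_left)
  from sum_squares_mod_11[OF this] have "11 dvd k - 4 * l" "11 dvd l" by auto
  then have "11 dvd k \<and> 11 dvd l" by presburger
  then show ?thesis using kl cong_P_iff by blast
qed

text \<open>
  Descent on \<open>\<pi>\<close>: a linear relation has both coefficients divisible by \<open>\<pi>\<close>, and dividing gives another
  relation; so the coefficients are divisible by all powers of \<open>\<pi>\<close>. In particular \<open>\<beta>\<close> does not lie in
  \<open>\<rat>(\<alpha>)\<close>.
\<close>

lemma independent:
  assumes "x \<in> A" "y \<in> A" "x + y * \<beta> = 0"
  shows "x = 0 \<and> y = 0"
proof -
  have "x \<in> (*) (\<pi> ^ n) ` A \<and> y \<in> (*) (\<pi> ^ n) ` A" for n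
    using assms
  proof (induction n arbitrary: x y)
    case (Suc n)
    have "Q x y = 0" using Suc.prems Q_factor[of x y] by simp
    then have "Q x y \<in> P" using of_int_P_iff[of 0] by simp
    then obtain x' y' where e: "x = \<pi> * x'" "y = \<pi> * y'" "x' \<in> A" "y' \<in> A"
      using Q_anisotropic Suc.prems unfolding P_def by blast
    have "\<pi> * (x' + y' * \<beta>) = 0" using Suc.prems(3) e by (simp add: algebra_simps)
    then have "x' \<in> (*) (\<pi> ^ n) ` A \<and> y' \<in> (*) (\<pi> ^ n) ` A"
      using \<pi>_nonzero e by (intro Suc.IH) auto
    then show ?case by (auto simp: e mult.assoc)
  qed simp
  then show ?thesis using A_separated assms by blast
qed

definition R :: "'a set"
  where "R = {x + y * \<beta> | x y. x \<in> A \<and> y \<in> A}"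

lemma R_I: "\<lbrakk>x \<in> A; y \<in> A\<rbrakk> \<Longrightarrow> x + y * \<beta> \<in> R"
  by (auto simp: R_def)

lemma R_E:
  assumes "r \<in> R" obtains x y where "x \<in> A" "y \<in> A" "r = x + y * \<beta>"
  using assms by (auto simp: R_def)

lemma A_subset_R: "x \<in> A \<Longrightarrow> x \<in> R"
  using R_I[of x 0] by simp

lemma R_add: "\<lbrakk>r \<in> R; s \<in> R\<rbrakk> \<Longrightarrow> r + s \<in> R"
proof (elim R_E)
  fix x y x' y'
  assume "x \<in> A" "y \<in> A" "x' \<in> A" "y' \<in> A" and e: "r = x + y * \<beta>" "s = x' + y' * \<beta>"
  then have "(x + x') + (y + y') * \<beta> \<in> R" by (intro R_I A_add)
  then show ?thesis by (simp add: e algebra_simps)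
qed

lemma R_minus: "r \<in> R \<Longrightarrow> - r \<in> R"
proof (elim R_E)
  fix x y
  assume "x \<in> A" "y \<in> A" and e: "r = x + y * \<beta>"
  then have "(- x) + (- y) * \<beta> \<in> R" by (intro R_I A_minus)
  then show ?thesis by (simp add: e)
qed

lemma R_mult: "\<lbrakk>r \<in> R; s \<in> R\<rbrakk> \<Longrightarrow> r * s \<in> R"
proof (elim R_E)
  fix x y x' y'
  assume "x \<in> A" "y \<in> A" "x' \<in> A" "y' \<in> A" and e: "r = x + y * \<beta>" "s = x' + y' * \<beta>"
  then have "(x * x' - y * y' * (\<alpha> ^ 2 - \<alpha>)) + (x * y' + y * x' + y * y' * (1 - \<alpha>)) * \<beta> \<in> R"
    by (intro R_I A_add A_mult A_diff A_power \<alpha>_A A_simps)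
  moreover have "r * s = (x * x' - y * y' * (\<alpha> ^ 2 - \<alpha>)) + (x * y' + y * x' + y * y' * (1 - \<alpha>)) * \<beta>"
    unfolding e using \<beta>_square by Groebner_Basis.algebra
  ultimately show ?thesis by simp
qed

lemma \<beta>_R: "\<beta> \<in> R"
  using R_I[of 0 1] by simp

lemma \<gamma>_R: "\<gamma> \<in> R"
  unfolding \<gamma>_eq using R_I[of "1 - \<alpha>" "- 1"] A_diff A_minus by simp

lemma \<pi>_multiple_iff:
  assumes "x \<in> A" "y \<in> A"
  shows "x + y * \<beta> \<in> (*) \<pi> ` R \<longleftrightarrow> x \<in> P \<and> y \<in> P"
proof
  assume "x + y * \<beta> \<in> (*) \<pi> ` R"
  then obtain x' y' where *: "x' \<in> A" "y' \<in> A" "x + y * \<beta> = \<pi> * (x' + y' * \<beta>)"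
    by (auto elim!: R_E)
  then have "(x - \<pi> * x') + (y - \<pi> * y') * \<beta> = 0" by (simp add: algebra_simps)
  then have "x - \<pi> * x' = 0 \<and> y - \<pi> * y' = 0"
    using assms * by (intro independent A_diff A_mult) auto
  then show "x \<in> P \<and> y \<in> P" using * by (auto simp: P_def)
next
  assume "x \<in> P \<and> y \<in> P"
  then obtain x' y' where *: "x' \<in> A" "y' \<in> A" "x = \<pi> * x'" "y = \<pi> * y'" by (auto simp: P_def)
  then have "x + y * \<beta> = \<pi> * (x' + y' * \<beta>)" by (simp add: algebra_simps)
  then show "x + y * \<beta> \<in> (*) \<pi> ` R" using * R_I by blast
qed

lemma \<pi>_multiple_A: "x \<in> A \<Longrightarrow> x \<in> (*) \<pi> ` R \<longleftrightarrow> x \<in> P"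
  using \<pi>_multiple_iff[of x 0] of_int_P_iff[of 0] by simp

text \<open>
  Taking relative norms reduces primality of \<open>\<pi>\<close> in \<open>\<int>[\<alpha>, \<beta>]\<close> to primality in \<open>\<int>[\<alpha>]\<close>, and
  anisotropy of the norm form brings divisibility back.
\<close>

lemma R_prime:
  assumes "r \<in> R" "s \<in> R" "r * s \<in> (*) \<pi> ` R"
  shows "r \<in> (*) \<pi> ` R \<or> s \<in> (*) \<pi> ` R"
proof -
  obtain x y where r: "x \<in> A" "y \<in> A" "r = x + y * \<beta>" using assms(1) by (rule R_E)
  obtain x' y' where s: "x' \<in> A" "y' \<in> A" "s = x' + y' * \<beta>" using assms(2) by (rule R_E)
  obtain t where t: "t \<in> R" "r * s = \<pi> * t" using assms(3) by blast
  have "Q x y * Q x' y' = \<pi> * (t * (x + y * \<gamma>) * (x' + y' * \<gamma>))"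
    using t(2) unfolding Q_factor[symmetric] r s by (simp add: mult_ac)
  moreover have "t * (x + y * \<gamma>) * (x' + y' * \<gamma>) \<in> R"
    using t(1) r s by (simp add: R_mult R_add A_subset_R \<gamma>_R)
  ultimately have "Q x y * Q x' y' \<in> (*) \<pi> ` R" by blast
  then have "Q x y * Q x' y' \<in> P" using r s by (simp add: \<pi>_multiple_A A_mult Q_A)
  then have "Q x y \<in> P \<or> Q x' y' \<in> P" using r s by (intro P_prime Q_A)
  then show ?thesis using r s Q_anisotropic \<pi>_multiple_iff by blast
qed

lemma R_separated:
  assumes "r \<in> R" "\<And>n. r \<in> (*) (\<pi> ^ n) ` R"
  shows "r = 0"
proof -
  obtain x y where r: "x \<in> A" "y \<in> A" "r = x + y * \<beta>" using assms(1) by (rule R_E)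
  have "x \<in> (*) (\<pi> ^ n) ` A \<and> y \<in> (*) (\<pi> ^ n) ` A" for n
  proof -
    obtain x' y' where *: "x' \<in> A" "y' \<in> A" "x + y * \<beta> = \<pi> ^ n * (x' + y' * \<beta>)"
      using assms(2)[of n] r by (auto elim!: R_E)
    then have "(x - \<pi> ^ n * x') + (y - \<pi> ^ n * y') * \<beta> = 0" by (simp add: algebra_simps)
    then have "x - \<pi> ^ n * x' = 0 \<and> y - \<pi> ^ n * y' = 0"
      using r * by (intro independent A_diff A_mult A_power) auto
    then show ?thesis using * by auto
  qed
  then have "x = 0" "y = 0" using A_separated r by blast+
  then show ?thesis using r by simp
qed

sublocale separated_prime R \<pi>
proof
  show "1 \<notin> (*) \<pi> ` R" using \<pi>_multiple_A[of 1] of_int_P_iff[of 1] by simp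
qed (use A_subset_R R_add R_minus R_mult \<pi>_nonzero R_prime R_separated in auto)

lemma unit_prime_to_p: "\<lbrakk>r \<in> R; s \<in> R; r * s = 1\<rbrakk> \<Longrightarrow> r \<in> prime_to_p"
  using not_unit R_mult unfolding prime_to_p_def by (auto simp: image_iff) (metis mult.assoc)

lemma roots_prime_to_p: "\<alpha> \<in> prime_to_p" "\<beta> \<in> prime_to_p"
proof -
  have "- (\<beta> * \<gamma>) \<in> R" "- (\<gamma> * \<alpha>) \<in> R" by (intro R_minus R_mult \<beta>_R \<gamma>_R A_subset_R \<alpha>_A)+
  moreover have "\<alpha> * - (\<beta> * \<gamma>) = 1" "\<beta> * - (\<gamma> * \<alpha>) = 1" using e3 by (simp_all add: mult_ac)
  ultimately show "\<alpha> \<in> prime_to_p" "\<beta> \<in> prime_to_p"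
    using unit_prime_to_p A_subset_R[OF \<alpha>_A] \<beta>_R by blast+
qed

text \<open>
  The element \<open>\<alpha> - 1 = - \<alpha>\<^sup>-\<^sup>2\<close> is a unit of the ring, so its value is 0 and not positive.
\<close>

lemma \<alpha>_not_principal: "\<alpha> \<notin> principal_units"
proof
  assume "\<alpha> \<in> principal_units"
  moreover have "\<alpha> - 1 \<in> prime_to_p"
  proof (rule unit_prime_to_p)
    show "\<alpha> - 1 \<in> R" "- (\<alpha> ^ 2) \<in> R"
      by (intro A_subset_R A_diff A_minus A_power \<alpha>_A A_simps)+
    show "(\<alpha> - 1) * - (\<alpha> ^ 2) = 1" using root by Groebner_Basis.algebra
  qed
  ultimately show False
    using val_prime_to_p prime_to_p_nonzero by (auto simp: principal_units_def)
qed

text \<open>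
  The product of \<open>\<Phi>\<^sub>5(\<beta>)\<close> and \<open>\<Phi>\<^sub>5(\<gamma>)\<close> is the adjugate \<open>11 / \<pi> = 7 - 9\<alpha> + 3\<alpha>\<^sup>2\<close>, which is congruent
  to 4 modulo \<open>\<pi>\<close>.
\<close>

lemma \<pi>'_prime_to_p: "3 * \<beta> ^ 2 - 1 \<in> prime_to_p"
proof -
  have R: "3 * \<delta> ^ 2 - 1 \<in> R" if "\<delta> \<in> R" for \<delta>
    unfolding power2_eq_square diff_conv_add_uminus using that
    by (simp only: R_add R_mult R_minus A_subset_R A_simps)
  have adjugate: "(3 * \<beta> ^ 2 - 1) * (3 * \<gamma> ^ 2 - 1) = 7 - 9 * \<alpha> + 3 * \<alpha> ^ 2"
    using e1 e2 e3 by Groebner_Basis.algebra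
  have "cong_P (7 - 9 * \<alpha> + 3 * \<alpha> ^ 2) (7 - 9 * 9 + 3 * 9 ^ 2)" by (intro cong_P_intros)
  then have "7 - 9 * \<alpha> + 3 * \<alpha> ^ 2 \<notin> P" using cong_P_iff by fastforce
  then have notin: "7 - 9 * \<alpha> + 3 * \<alpha> ^ 2 \<notin> (*) \<pi> ` R"
    by (subst \<pi>_multiple_A) (intro A_add A_mult A_diff A_power \<alpha>_A A_simps)
  have "3 * \<beta> ^ 2 - 1 \<notin> (*) \<pi> ` R"
  proof
    assume "3 * \<beta> ^ 2 - 1 \<in> (*) \<pi> ` R"
    then obtain t where t: "t \<in> R" "3 * \<beta> ^ 2 - 1 = \<pi> * t" by blast
    have "7 - 9 * \<alpha> + 3 * \<alpha> ^ 2 = \<pi> * (t * (3 * \<gamma> ^ 2 - 1))"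
      unfolding adjugate[symmetric] t(2) by (rule mult.assoc)
    then show False using notin R_mult[OF t(1) R[OF \<gamma>_R]] by blast
  qed
  then show ?thesis using R[OF \<beta>_R] by (simp add: prime_to_p_def)
qed

lemma tame_\<alpha>: "tame \<alpha> (3 * \<alpha> ^ 2 - 1) = \<alpha>"
  unfolding \<pi>_def[symmetric] using val_p val_prime_to_p[OF roots_prime_to_p(1)] by (simp add: tame_def)

lemma tame_\<beta>: "tame \<beta> (3 * \<beta> ^ 2 - 1) = 1"
  using val_prime_to_p[OF roots_prime_to_p(2)] val_prime_to_p[OF \<pi>'_prime_to_p] by (simp add: tame_def)

end

section \<open>Separating the three subgroups\<close>

context rational_adjunction
begin

text \<open>
  Modulo principal units the tame symbol factors through \<open>K\<^sub>2(F)\<close>, and the kernel of the resulting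
  homomorphism is a subgroup containing \<open>{c, d}\<close> but not \<open>{a, b}\<close>. The quotient of the nonzero complex numbers by the principal units serves
  as target of the homomorphism.
\<close>

lemma K2_symbol_notin_generate:
  assumes "valued_field K v" and FK: "carrier F \<subseteq> K"
    and nz: "a \<in> nonzero_elements F" "b \<in> nonzero_elements F" "c \<in> nonzero_elements F" "d \<in> nonzero_elements F"
    and ab: "valued_field.tame v a b \<notin> valued_field.principal_units K v"
    and cd: "valued_field.tame v c d \<in> valued_field.principal_units K v"
  shows "K2_symbol F a b \<notin> generate (K2 F) {K2_symbol F c d}"
proof -
  interpret v: valued_field K v by fact
  interpret K2: comm_group "K2 F" by (rule comm_group_K2)
  define U where "U = units_of (ring_of_type_algebra :: complex ring)"
  interpret C: field "ring_of_type_algebra :: complex ring" by (rule field_from_type_algebra)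
  interpret U: comm_group U unfolding U_def by (rule C.units_comm_group)
  have carrier_U: "x \<in> carrier U \<longleftrightarrow> x \<noteq> 0" for x
    unfolding U_def units_of_carrier C.field_Units by (simp add: ring_of_type_algebra_def)
  have mult_U: "x \<otimes>\<^bsub>U\<^esub> y = x * y" for x y
    by (simp add: U_def units_of_mult ring_of_type_algebra_def)
  have one_U: "\<one>\<^bsub>U\<^esub> = 1" by (simp add: U_def units_of_one ring_of_type_algebra_def)
  have one_V: "1 \<in> v.principal_units" by (simp add: v.principal_units_def v.one_mem)
  have V: "subgroup v.principal_units U"
  proof (rule U.subgroupI)
    show "v.principal_units \<subseteq> carrier U" by (auto simp: v.principal_units_def carrier_U)
    show "v.principal_units \<noteq> {}" using one_V by blast
    show "inv\<^bsub>U\<^esub> x \<in> v.principal_units" if "x \<in> v.principal_units" for x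
    proof -
      have "x \<noteq> 0" using that by (simp add: v.principal_units_def)
      then have "inv\<^bsub>U\<^esub> x = inverse x" by (intro U.inv_equality) (auto simp: carrier_U mult_U one_U)
      then show ?thesis using v.principal_units_inverse that by simp
    qed
    show "x \<otimes>\<^bsub>U\<^esub> y \<in> v.principal_units" if "x \<in> v.principal_units" "y \<in> v.principal_units" for x y
      using v.principal_units_mult that by (simp add: mult_U)
  qed
  define G where "G = U Mod v.principal_units"
  have G: "comm_group G" unfolding G_def by (rule U.abelian_FactGroup) (rule V)
  have hom: "(\<lambda>x. v.principal_units #>\<^bsub>U\<^esub> x) \<in> hom U G"
    unfolding G_def by (rule normal.r_coset_hom_Mod) (rule U.subgroup_imp_normal[OF V])
  have class_one: "v.principal_units #>\<^bsub>U\<^esub> x = \<one>\<^bsub>G\<^esub> \<longleftrightarrow> x \<in> v.principal_units" if "x \<noteq> 0" for x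
    unfolding G_def using U.coset_join1[OF _ _ V, of x] U.coset_join2[OF _ V, of x] that V
    by (auto simp: carrier_U subgroup.subset)
  have mem: "x \<in> K" "x \<noteq> 0" if "x \<in> nonzero_elements F" for x
    using that FK by (auto simp: mem_F_iff)
  obtain \<phi> where \<phi>: "\<phi> \<in> hom (K2 F) G"
    "\<And>x y. \<lbrakk>x \<in> nonzero_elements F; y \<in> nonzero_elements F\<rbrakk>
      \<Longrightarrow> \<phi> (K2_symbol F x y) = v.principal_units #>\<^bsub>U\<^esub> v.tame x y"
  proof (rule K2_universal[OF G, of "\<lambda>x y. v.principal_units #>\<^bsub>U\<^esub> v.tame x y"])
    show "v.principal_units #>\<^bsub>U\<^esub> v.tame x y \<in> carrier G"
      if "x \<in> nonzero_elements F" "y \<in> nonzero_elements F" for x y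
      using hom_in_carrier[OF hom] v.tame_nonzero mem that by (simp add: carrier_U)
    show "v.principal_units #>\<^bsub>U\<^esub> v.tame (x \<otimes>\<^bsub>F\<^esub> y) z
        = (v.principal_units #>\<^bsub>U\<^esub> v.tame x z) \<otimes>\<^bsub>G\<^esub> (v.principal_units #>\<^bsub>U\<^esub> v.tame y z)"
      if "x \<in> nonzero_elements F" "y \<in> nonzero_elements F" "z \<in> nonzero_elements F" for x y z
      using hom_mult[OF hom, of "v.tame x z" "v.tame y z"] that mem
      by (simp add: v.tame_mult_left v.tame_nonzero carrier_U mult_U)
    show "v.principal_units #>\<^bsub>U\<^esub> v.tame x (y \<otimes>\<^bsub>F\<^esub> z)
        = (v.principal_units #>\<^bsub>U\<^esub> v.tame x y) \<otimes>\<^bsub>G\<^esub> (v.principal_units #>\<^bsub>U\<^esub> v.tame x z)"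
      if "x \<in> nonzero_elements F" "y \<in> nonzero_elements F" "z \<in> nonzero_elements F" for x y z
      using hom_mult[OF hom, of "v.tame x y" "v.tame x z"] that mem
      by (simp add: v.tame_mult_right v.tame_nonzero carrier_U mult_U)
    show "v.principal_units #>\<^bsub>U\<^esub> v.tame x (\<one>\<^bsub>F\<^esub> \<ominus>\<^bsub>F\<^esub> x) = \<one>\<^bsub>G\<^esub>"
      if "x \<in> nonzero_elements F" "x \<noteq> \<one>\<^bsub>F\<^esub>" for x
    proof -
      have x: "x \<in> K" "x \<noteq> 0" "x \<noteq> 1" using that mem by auto
      have "\<one>\<^bsub>F\<^esub> \<ominus>\<^bsub>F\<^esub> x = 1 - x" using that one_closed by (simp add: minus_eq mem_F_iff)
      then show ?thesis using v.tame_steinberg[OF x] x by (simp add: class_one v.tame_nonzero)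
    qed
  qed blast
  interpret \<phi>: group_hom "K2 F" G \<phi>
    using \<phi>(1) G by (simp add: group_hom_def group_hom_axioms_def comm_group_def K2.group_axioms)
  have "\<phi> (K2_symbol F c d) = \<one>\<^bsub>G\<^esub>"
    using cd nz mem by (simp add: \<phi>(2) class_one v.tame_nonzero)
  then have "K2_symbol F c d \<in> kernel (K2 F) G \<phi>"
    using nz by (simp add: kernel_def K2_symbol_closed)
  then have "generate (K2 F) {K2_symbol F c d} \<subseteq> kernel (K2 F) G \<phi>"
    by (intro K2.generate_subgroup_incl \<phi>.subgroup_kernel) auto
  moreover have "K2_symbol F a b \<notin> kernel (K2 F) G \<phi>"
    using ab nz mem by (simp add: kernel_def \<phi>(2) class_one v.tame_nonzero)
  ultimately show ?thesis by blast
qed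

lemma carrier_subset_valued_field:
  assumes "valued_field K v" "S \<subseteq> K"
  shows "carrier F \<subseteq> K"
proof
  interpret v: valued_field K v by fact
  interpret C: field "ring_of_type_algebra :: complex ring" by (rule field_from_type_algebra)
  have of_nat: "of_nat n \<in> K" for n
    using v.add_mem[of "- 1" 1] v.minus_mem[of 1] v.one_mem v.add_mem by (induction n) auto
  have of_int: "of_int n \<in> K" for n
    by (cases n rule: int_diff_cases) (simp add: of_nat v.diff_mem)
  have ops: "x \<otimes>\<^bsub>ring_of_type_algebra\<^esub> y = x * y" "x \<oplus>\<^bsub>ring_of_type_algebra\<^esub> y = x + y"
    "\<one>\<^bsub>ring_of_type_algebra\<^esub> = (1 :: complex)" "\<zero>\<^bsub>ring_of_type_algebra\<^esub> = (0 :: complex)"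
    "x \<in> carrier ring_of_type_algebra" for x y :: complex
    by (simp_all add: ring_of_type_algebra_def)
  fix x assume "x \<in> carrier F"
  then have "x \<in> generate_field ring_of_type_algebra (\<rat> \<union> S)" by (simp add: F rat_adjoin_def)
  then show "x \<in> K"
  proof (induction rule: generate_field.induct)
    case one
    then show ?case by (simp add: ops v.one_mem)
  next
    case (incl h)
    then show ?case
    proof
      assume "h \<in> \<rat>"
      then obtain m n :: int where "h = of_int m / of_int n" by (auto elim: Rats_cases')
      then show ?thesis by (simp add: divide_inverse v.mult_mem v.inverse_mem of_int)
    qed (use assms in auto)
  next
    case (a_inv h)
    have "\<ominus>\<^bsub>ring_of_type_algebra\<^esub> h = - h"
      using C.l_neg[of h] by (simp add: ops eq_neg_iff_add_eq_0)
    then show ?case using a_inv by (simp add: v.minus_mem)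
  next
    case (m_inv h)
    have "h * inv\<^bsub>ring_of_type_algebra\<^esub> h = 1"
      using C.Units_r_inv[of h] m_inv by (simp add: ops C.field_Units)
    then have "inv\<^bsub>ring_of_type_algebra\<^esub> h = inverse h" using inverse_unique by metis
    then show ?case using m_inv by (simp add: v.inverse_mem)
  qed (simp_all add: ops v.add_mem v.mult_mem)
qed

text \<open>
  The valuation at the prime \<open>\<Phi>\<^sub>5(\<alpha>)\<close> distinguishes \<open>\<alpha>\<close> from the two other roots.
\<close>

lemma c5_notin_generate:
  assumes "cubic_roots \<alpha> \<beta> \<gamma>" "S = {\<alpha>, \<beta>, \<gamma>}"
  shows "c5 F \<alpha> \<notin> generate (K2 F) {c5 F \<beta>}"
proof -
  interpret cubic_roots \<alpha> \<beta> \<gamma> by fact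
  have roots: "\<alpha> ^ 3 - \<alpha> ^ 2 + 1 = 0" "\<beta> ^ 3 - \<beta> ^ 2 + 1 = 0"
    using e1 e2 e3 by Groebner_Basis.algebra+
  have Phi5: "Phi5 F x = 3 * x ^ 2 - 1" if "x ^ 3 - x ^ 2 + 1 = 0" for x
    unfolding Phi5_eq using that by Groebner_Basis.algebra
  have mem: "\<alpha> \<in> carrier F" "\<beta> \<in> carrier F" by (auto simp: F assms intro!: rat_adjoin_incl)
  have sub: "carrier F \<subseteq> fractions"
    by (rule carrier_subset_valued_field[of fractions val])
      (auto simp: assms valued_field_axioms fractions_incl A_subset_R \<beta>_R \<gamma>_R)
  show ?thesis
    unfolding c5_def
  proof (rule K2_symbol_notin_generate[OF valued_field_axioms sub])
    show "tame \<alpha> (Phi5 F \<alpha>) \<notin> principal_units"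
      by (simp add: Phi5 roots tame_\<alpha> \<alpha>_not_principal)
    show "tame \<beta> (Phi5 F \<beta>) \<in> principal_units"
      by (simp add: Phi5 roots tame_\<beta> principal_units_def one_mem fractions_incl)
  qed (use a_unit Phi5_unit mem roots in auto)
qed

end

lemma cubic_roots_of_proots:
  assumes "proots [:1, 0, -1, 1:] = {#\<alpha>, \<beta>, \<gamma> :: complex#}"
  shows "cubic_roots \<alpha> \<beta> \<gamma>"
proof
  have "smult (lead_coeff [:1, 0, -1, 1:]) (\<Prod>x\<in>#{#\<alpha>, \<beta>, \<gamma>#}. [:- x, 1:]) = [:1, 0, -1, 1:]"
    using complex_poly_decompose_multiset[of "[:1, 0, -1, 1:]"] unfolding assms .
  note coeffs = this[simplified]
  show "\<alpha> + \<beta> + \<gamma> = 1"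
    using coeffs by (elim conjE) Groebner_Basis.algebra
  show "\<alpha> * \<beta> + \<beta> * \<gamma> + \<gamma> * \<alpha> = 0"
    using coeffs by (elim conjE) Groebner_Basis.algebra
  show "\<alpha> * \<beta> * \<gamma> = - 1"
    using coeffs by (elim conjE) Groebner_Basis.algebra
qed

theorem mainTheorem3:
  fixes \<alpha>\<^sub>1 \<alpha>\<^sub>2 \<alpha>\<^sub>3 :: complex and F :: "complex ring"
  assumes roots: "proots [:1, 0, -1, 1:] = {#\<alpha>\<^sub>1, \<alpha>\<^sub>2, \<alpha>\<^sub>3#}"
    and F: "F = rat_adjoin {\<alpha>\<^sub>1, \<alpha>\<^sub>2, \<alpha>\<^sub>3}"
  shows "{\<alpha>\<^sub>1, \<alpha>\<^sub>2, \<alpha>\<^sub>3} \<subseteq> c5_domain F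
    \<and> nontrivial_cyclotomic_subgroup F (generate (K2 F) {c5 F \<alpha>\<^sub>1})
    \<and> nontrivial_cyclotomic_subgroup F (generate (K2 F) {c5 F \<alpha>\<^sub>2})
    \<and> nontrivial_cyclotomic_subgroup F (generate (K2 F) {c5 F \<alpha>\<^sub>3})
    \<and> generate (K2 F) {c5 F \<alpha>\<^sub>1} \<noteq> generate (K2 F) {c5 F \<alpha>\<^sub>2}
    \<and> generate (K2 F) {c5 F \<alpha>\<^sub>1} \<noteq> generate (K2 F) {c5 F \<alpha>\<^sub>3}
    \<and> generate (K2 F) {c5 F \<alpha>\<^sub>2} \<noteq> generate (K2 F) {c5 F \<alpha>\<^sub>3}
    \<and> (\<exists>\<H>. card \<H> = 3 \<and> (\<forall>H\<in>\<H>. nontrivial_cyclotomic_subgroup F H))"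
proof -
  define S where "S = {\<alpha>\<^sub>1, \<alpha>\<^sub>2, \<alpha>\<^sub>3}"
  interpret rational_adjunction S F by unfold_locales (simp add: S_def F)
  define H where "H x = generate (K2 F) {c5 F x}" for x
  have perm: "proots [:1, 0, -1, 1:] = {#\<alpha>\<^sub>2, \<alpha>\<^sub>3, \<alpha>\<^sub>1#}" "proots [:1, 0, -1, 1:] = {#\<alpha>\<^sub>3, \<alpha>\<^sub>1, \<alpha>\<^sub>2#}"
    using roots by (simp_all add: add_mset_commute)
  \<comment> \<open>The three cyclic permutations suffice: each root occurs once on the left, which gives nontriviality, and each pair of roots occurs once, which gives distinctness.\<close>
  have notin: "c5 F \<alpha>\<^sub>1 \<notin> H \<alpha>\<^sub>2" "c5 F \<alpha>\<^sub>2 \<notin> H \<alpha>\<^sub>3" "c5 F \<alpha>\<^sub>3 \<notin> H \<alpha>\<^sub>1"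
    unfolding H_def
    using roots[THEN cubic_roots_of_proots] perm[THEN cubic_roots_of_proots]
    by (auto dest!: c5_notin_generate simp: S_def)
  have self: "c5 F x \<in> H x" and one: "\<one>\<^bsub>K2 F\<^esub> \<in> H x" for x
    unfolding H_def by (auto intro: generate.incl generate.one)
  have distinct: "H \<alpha>\<^sub>1 \<noteq> H \<alpha>\<^sub>2" "H \<alpha>\<^sub>1 \<noteq> H \<alpha>\<^sub>3" "H \<alpha>\<^sub>2 \<noteq> H \<alpha>\<^sub>3"
    using notin self by metis+
  have root: "x ^ 3 - x ^ 2 + 1 = 0" and mem: "x \<in> carrier F" if "x \<in> {\<alpha>\<^sub>1, \<alpha>\<^sub>2, \<alpha>\<^sub>3}" for x
  proof -
    have "x \<in># proots [:1, 0, -1, 1:]" using that unfolding roots by auto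
    then show "x ^ 3 - x ^ 2 + 1 = 0" by (simp add: algebra_simps power2_eq_square power3_eq_cube)
    show "x \<in> carrier F" using that rat_adjoin_incl[of x S] by (simp add: F S_def)
  qed
  have "c5 F x \<noteq> \<one>\<^bsub>K2 F\<^esub>" if "x \<in> {\<alpha>\<^sub>1, \<alpha>\<^sub>2, \<alpha>\<^sub>3}" for x
    using that notin one by auto
  then have "H x \<noteq> {\<one>\<^bsub>K2 F\<^esub>}" if "x \<in> {\<alpha>\<^sub>1, \<alpha>\<^sub>2, \<alpha>\<^sub>3}" for x
    using that self[of x] by auto
  then have nontrivial: "nontrivial_cyclotomic_subgroup F (H x)" if "x \<in> {\<alpha>\<^sub>1, \<alpha>\<^sub>2, \<alpha>\<^sub>3}" for x
    unfolding nontrivial_cyclotomic_subgroup_def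
    using that cyclotomic_subgroup_c5 root mem by (auto simp: H_def)
  have "{\<alpha>\<^sub>1, \<alpha>\<^sub>2, \<alpha>\<^sub>3} \<subseteq> c5_domain F"
    unfolding c5_domain_def using a_unit Phi5_unit root mem by blast
  moreover have "card {H \<alpha>\<^sub>1, H \<alpha>\<^sub>2, H \<alpha>\<^sub>3} = 3" using distinct by simp
  then have "\<exists>\<H>. card \<H> = 3 \<and> (\<forall>H\<in>\<H>. nontrivial_cyclotomic_subgroup F H)"
    using nontrivial by (intro exI[of _ "{H \<alpha>\<^sub>1, H \<alpha>\<^sub>2, H \<alpha>\<^sub>3}"]) auto
  ultimately show ?thesis using nontrivial distinct by (simp add: H_def)
qed

end
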